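(* Let $d$ be a positive integer, let $G=(V,E)$ be a graph on at least three vertices, and let $u,v\in V$. If $\{u,v\}$ is vertex-redundantly $d$-linked in $G$, then $\{u,v\}$ is globally $d$-linked in $G$.
   Context: All graphs are finite and simple. A framework in $\mathbb{R}^d$ is a pair $(G,p)$ with $p:V\to\mathbb{R}^d$; it is generic if the coordinates of all $p(v)$ are algebraically independent over $\mathbb{Q}$. The rigidity matrix $R(G,p)$ has a row for each edge $uv$ with $p(u)-p(v)$ in the $d$ columns of $u$, $p(v)-p(u)$ in the $d$ columns of $v$, zeros elsewhere; the $d$-dimensional generic rigidity matroid $\mathcal{R}_d(G)$ is the row matroid of $R(G,p)$ for generic $p$, with rank $r_d(G)$. A pair $\{u,v\}$ is $d$-linked in $G$ if $r_d(G+uv)=r_d(G)$. It is vertex-redundantly $d$-linked in $G$ if $\{u,v\}$ is $d$-linked in $G-z$ for every $z\in V-\{u,v\}$. It is globally $d$-linked in $G$ if for every generic framework $(G,p)$ in $\mathbb{R}^d$ and every framework $(G,q)$ in $\mathbb{R}^d$ with $\|p(x)-p(y)\|=\|q(x)-q(y)\|$ for all edges $xy$, we have $\|p(u)-p(v)\|=\|q(u)-q(v)\|$. *)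

theory Defs
  imports "HOL-Analysis.Analysis" "HOL-Library.Poly_Mapping" "HOL-Library.Function_Algebras"
begin

section \<open>Graphs\<close>

type_synonym 'v graph = "'v set \<times> 'v set set"

abbreviation verts :: "'v graph \<Rightarrow> 'v set" where "verts \<equiv> fst"
abbreviation edges :: "'v graph \<Rightarrow> 'v set set" where "edges \<equiv> snd"

definition finite_simple_graph :: "'v graph \<Rightarrow> bool" where
  "finite_simple_graph G \<longleftrightarrow> finite (verts G) \<and> (\<forall>e\<in>edges G. e \<subseteq> verts G \<and> card e = 2)"

definition add_edge :: "'v graph \<Rightarrow> 'v \<Rightarrow> 'v \<Rightarrow> 'v graph" where
  "add_edge G u v = (verts G, insert {u, v} (edges G))"

definition delete_vertex :: "'v graph \<Rightarrow> 'v \<Rightarrow> 'v graph" where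
  "delete_vertex G z = (verts G - {z}, {e \<in> edges G. z \<notin> e})"


section \<open>Generic frameworks\<close>

text \<open>Polynomials over the rationals in variables of type \<open>'i\<close> are finitely supported maps from
  monomials (finitely supported exponent vectors) to coefficients.\<close>

type_synonym 'i rat_mpoly = "('i \<Rightarrow>\<^sub>0 nat) \<Rightarrow>\<^sub>0 rat"

definition mpoly_eval :: "('i \<Rightarrow> real) \<Rightarrow> 'i rat_mpoly \<Rightarrow> real" where
  "mpoly_eval x f =
    (\<Sum>m\<in>Poly_Mapping.keys f. of_rat (Poly_Mapping.lookup f m) *
       (\<Prod>i\<in>Poly_Mapping.keys m. x i ^ Poly_Mapping.lookup m i))"

definition alg_independent_over_rat :: "'i set \<Rightarrow> ('i \<Rightarrow> real) \<Rightarrow> bool" where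
  "alg_independent_over_rat I x \<longleftrightarrow>
    (\<forall>f :: 'i rat_mpoly. (\<forall>m\<in>Poly_Mapping.keys f. Poly_Mapping.keys m \<subseteq> I) \<and> mpoly_eval x f = 0
       \<longrightarrow> f = 0)"

text \<open>A framework is given by a total map \<open>p\<close>; only its values on the vertex set matter.\<close>

definition generic :: "'v graph \<Rightarrow> ('v \<Rightarrow> real ^ 'd::finite) \<Rightarrow> bool" where
  "generic G p \<longleftrightarrow> alg_independent_over_rat (verts G \<times> (UNIV :: 'd set)) (\<lambda>(v, i). p v $ i)"


section \<open>The rigidity matrix and the generic rank\<close>

text \<open>Rows are indexed by edges, columns by pairs of a vertex and a coordinate. For an edge
  \<open>e = {u, v}\<close> and an endvertex \<open>w\<close> of \<open>e\<close> the sum below has exactly one term, which belongs to the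
  other endvertex of \<open>e\<close>; writing it this way avoids choosing an orientation of \<open>e\<close>.
  Columns of elements outside the vertex set are zero.\<close>

definition rigidity_matrix :: "('v \<Rightarrow> real ^ 'd) \<Rightarrow> 'v set \<Rightarrow> 'v \<times> 'd \<Rightarrow> real" where
  "rigidity_matrix p e = (\<lambda>(w, i). if w \<in> e then (\<Sum>x\<in>e - {w}. (p w - p x) $ i) else 0)"

lemma rigidity_matrix_edge:
  assumes "u \<noteq> v"
  shows "rigidity_matrix p {u, v} (w, i) =
    (if w = u then (p u - p v) $ i else if w = v then (p v - p u) $ i else 0)"
proof -
  have "{u, v} - {u} = {v}" "{u, v} - {v} = {u}" using assms by auto
  then show ?thesis by (auto simp: rigidity_matrix_def)
qed

definition row_scale :: "real \<Rightarrow> ('c \<Rightarrow> real) \<Rightarrow> 'c \<Rightarrow> real" where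
  "row_scale a r = (\<lambda>j. a * r j)"

lemma vector_space_row_scale: "vector_space (row_scale :: real \<Rightarrow> ('c \<Rightarrow> real) \<Rightarrow> 'c \<Rightarrow> real)"
  by unfold_locales (simp_all add: row_scale_def fun_eq_iff algebra_simps)

definition rigidity_matrix_rank :: "'v graph \<Rightarrow> ('v \<Rightarrow> real ^ 'd) \<Rightarrow> nat" where
  "rigidity_matrix_rank G p = vector_space.dim row_scale (rigidity_matrix p ` edges G)"

text \<open>The rank of the rigidity matrix is the same for all generic \<open>p\<close>, so it does not matter which
  generic \<open>p\<close> is selected here. The dimension is the cardinality of the type \<open>'d\<close>.\<close>

definition rigidity_rank :: "'d::finite itself \<Rightarrow> 'v graph \<Rightarrow> nat" where
  "rigidity_rank D G = rigidity_matrix_rank G (SOME p :: 'v \<Rightarrow> real ^ 'd. generic G p)"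


section \<open>Linked and globally linked pairs\<close>

definition linked :: "'d::finite itself \<Rightarrow> 'v graph \<Rightarrow> 'v \<Rightarrow> 'v \<Rightarrow> bool" where
  "linked D G u v \<longleftrightarrow> rigidity_rank D (add_edge G u v) = rigidity_rank D G"

definition vertex_redundantly_linked :: "'d::finite itself \<Rightarrow> 'v graph \<Rightarrow> 'v \<Rightarrow> 'v \<Rightarrow> bool" where
  "vertex_redundantly_linked D G u v \<longleftrightarrow>
    (\<forall>z \<in> verts G - {u, v}. linked D (delete_vertex G z) u v)"

definition globally_linked :: "'d::finite itself \<Rightarrow> 'v graph \<Rightarrow> 'v \<Rightarrow> 'v \<Rightarrow> bool" where
  "globally_linked D G u v \<longleftrightarrow>
    (\<forall>(p :: 'v \<Rightarrow> real ^ 'd) (q :: 'v \<Rightarrow> real ^ 'd). generic G p \<and>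
       (\<forall>x y. {x, y} \<in> edges G \<longrightarrow> norm (p x - p y) = norm (q x - q y))
       \<longrightarrow> norm (p u - p v) = norm (q u - q v))"

end

theory Submission
  imports Defs "HOL-Computational_Algebra.Polynomial"
begin

text \<open>
  Let \<open>p\<close> be generic, \<open>q\<close> equivalent to \<open>p\<close>, and write \<open>\<alpha> = |p u - p v|\<^sup>2\<close>, \<open>\<beta> = |q u - q v|\<^sup>2\<close>.
  If \<open>{u, v}\<close> is linked in \<open>G - z\<close>, then \<open>\<alpha>\<close> is algebraic over the ring generated by the squared edge
  lengths \<open>\<alpha>\<^sub>e\<close> of \<open>G - z\<close>: otherwise a derivation of \<open>\<real>\<close> killing all \<open>\<alpha>\<^sub>e\<close> but not \<open>\<alpha>\<close>, applied to the
  coordinates, is an infinitesimal motion that changes the distance of \<open>u\<close> and \<open>v\<close>. The minimal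
  polynomial of \<open>\<alpha>\<close> is a polynomial identity between lengths in any framework, so \<open>\<beta>\<close> is a root of it, and
  a simple one. Differentiating the identity at \<open>q\<close> gives weights \<open>b\<close> on the edges such that
  \<open>(b, -1)\<close> is a stress of \<open>(G + uv, q)\<close> and \<open>D \<beta> = \<Sum> b\<^sub>e D \<alpha>\<^sub>e\<close> for all derivations \<open>D\<close> of \<open>\<real>\<close>.

  Since \<open>\<beta>\<close> is algebraic over the coordinates of the vertices other than \<open>z\<close>, for every \<open>z \<noteq> u, v\<close>, it is
  killed by the derivation \<open>\<partial>/\<partial>p\<^bsub>z,i\<^esub>\<close>. Hence \<open>\<Sum> b\<^sub>e row\<^sub>e(p)\<close> has the form \<open>\<gamma>\<close> at \<open>u\<close>, \<open>-\<gamma>\<close> at \<open>v\<close> and \<open>0\<close>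
  elsewhere. Pairing the \<open>b\<close>-weighted Laplacian with \<open>p\<close> on one side and \<open>q\<close> on the other, in both ways,
  yields \<open>(q u - q v) \<otimes> (p u - p v) = (q u - q v) \<otimes> \<gamma>\<close>. As \<open>0\<close> is not a root of the
  minimal polynomial, \<open>q u \<noteq> q v\<close>. So \<open>\<gamma> = p u - p v\<close>, and
  \<open>\<alpha> = \<Sum> b\<^sub>e \<alpha>\<^sub>e = \<beta>\<close>.
\<close>

section \<open>Subrings of the reals and their derivations\<close>

definition subring :: "real set \<Rightarrow> bool" where
  "subring M \<longleftrightarrow> 1 \<in> M \<and> (\<forall>a\<in>M. - a \<in> M) \<and> (\<forall>a\<in>M. \<forall>b\<in>M. a + b \<in> M \<and> a * b \<in> M)"

lemma subring_simps:
  assumes "subring M"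
  shows "1 \<in> M" "a \<in> M \<Longrightarrow> - a \<in> M" "a \<in> M \<Longrightarrow> b \<in> M \<Longrightarrow> a + b \<in> M"
    "a \<in> M \<Longrightarrow> b \<in> M \<Longrightarrow> a * b \<in> M"
  using assms by (auto simp: subring_def)

lemma subring_0: assumes "subring M" shows "0 \<in> M"
proof -
  have "1 + - 1 \<in> M" using assms subring_simps by blast
  then show ?thesis by simp
qed

lemma subring_diff:
  assumes "subring M" "a \<in> M" "b \<in> M" shows "a - b \<in> M"
proof -
  have "a + - b \<in> M" using assms subring_simps by blast
  then show ?thesis by simp
qed

lemma subring_sum:
  assumes "subring M" "\<And>i. i \<in> A \<Longrightarrow> f i \<in> M" shows "sum f A \<in> M"
  using assms(2)
  by (induction A rule: infinite_finite_induct)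
     (auto intro: subring_0[OF assms(1)] subring_simps[OF assms(1)])

lemma subring_of_nat: assumes "subring M" shows "of_nat n \<in> M"
  by (induction n) (auto intro: subring_0[OF assms] subring_simps[OF assms])

section \<open>Pseudo-division and minimal polynomials over a subring\<close>

definition coeffs_in :: "real set \<Rightarrow> real poly \<Rightarrow> bool" where
  "coeffs_in M f \<longleftrightarrow> (\<forall>i. coeff f i \<in> M)"

lemma coeffs_in_mult:
  assumes "subring M" "coeffs_in M f" "coeffs_in M g" shows "coeffs_in M (f * g)"
  using assms unfolding coeffs_in_def coeff_mult
  by (auto intro!: subring_sum subring_simps(4))

lemma coeffs_in_diff:
  assumes "subring M" "coeffs_in M f" "coeffs_in M g" shows "coeffs_in M (f - g)"
  using assms unfolding coeffs_in_def by (auto intro!: subring_diff)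

lemma coeffs_in_add:
  assumes "subring M" "coeffs_in M f" "coeffs_in M g" shows "coeffs_in M (f + g)"
  using assms unfolding coeffs_in_def by (auto intro!: subring_simps(3))

lemma coeffs_in_smult:
  assumes "subring M" "a \<in> M" "coeffs_in M f" shows "coeffs_in M (smult a f)"
  using assms unfolding coeffs_in_def by (auto intro!: subring_simps(4))

lemma coeffs_in_monom:
  assumes "subring M" "a \<in> M" shows "coeffs_in M (monom a n)"
  using assms unfolding coeffs_in_def by (auto intro!: subring_0)

lemma coeffs_in_pderiv:
  assumes "subring M" "coeffs_in M f" shows "coeffs_in M (pderiv f)"
  using assms subring_of_nat[OF assms(1), of "Suc _"] unfolding coeffs_in_def coeff_pderiv
  by (auto intro!: subring_simps(4))

text \<open>Without inverses in \<open>M\<close>, long division needs \<open>f\<close> to be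
  multiplied by a power of the leading coefficient of \<open>m\<close>; each round cancels the
  leading term of the dividend.\<close>

lemma pseudo_division:
  assumes M: "subring M" and m: "coeffs_in M m" "m \<noteq> 0" and f: "coeffs_in M f"
  shows "\<exists>k q r. smult (lead_coeff m ^ k) f = m * q + r \<and> coeffs_in M q \<and> coeffs_in M r
    \<and> (r = 0 \<or> degree r < degree m)"
  using f
proof (induction "degree f" arbitrary: f rule: less_induct)
  case less
  show ?case
  proof (cases "f = 0 \<or> degree f < degree m")
    case True
    have "smult (lead_coeff m ^ 0) f = m * 0 + f" by simp
    moreover have "coeffs_in M 0" using subring_0[OF M] by (simp add: coeffs_in_def)
    ultimately show ?thesis using True less.prems by blast
  next
    case False
    define t where "t = monom (lead_coeff f) (degree f - degree m)"
    define f1 where "f1 = smult (lead_coeff m) f - m * t"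
    have lm: "lead_coeff m \<in> M" "lead_coeff f \<in> M"
      using m less.prems by (auto simp: coeffs_in_def)
    have t: "coeffs_in M t" unfolding t_def using coeffs_in_monom[OF M lm(2)] .
    have f1: "coeffs_in M f1" unfolding f1_def
      by (intro coeffs_in_diff coeffs_in_smult coeffs_in_mult M lm less.prems m t)
    have "lead_coeff f \<noteq> 0" using False by simp
    then have dt: "degree t = degree f - degree m" "t \<noteq> 0"
      unfolding t_def by (simp_all add: degree_monom_eq)
    then have deg_mt: "degree (m * t) = degree f"
      using False m(2) by (simp add: degree_mult_eq)
    have lc_mt: "lead_coeff (m * t) = lead_coeff m * lead_coeff f"
      unfolding lead_coeff_mult dt(1) by (simp add: t_def)
    have le: "degree f1 \<le> degree f"
      unfolding f1_def using deg_mt by (intro degree_diff_le) auto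
    have "coeff f1 (degree f) = 0"
      unfolding f1_def using lc_mt deg_mt by simp
    then have c: "f1 = 0 \<or> degree f1 < degree f"
      using le by (metis leading_coeff_0_iff le_neq_implies_less)
    \<comment> \<open>For a nonzero constant \<open>f\<close> one gets \<open>f1 = 0\<close>, also
      of degree 0, so the degree does not drop; the division is then exact already.\<close>
    show ?thesis
    proof (cases "degree f1 < degree f")
      case True
      from less.hyps[OF True f1] obtain k q r where
        k: "smult (lead_coeff m ^ k) f1 = m * q + r" "coeffs_in M q" "coeffs_in M r"
           "r = 0 \<or> degree r < degree m" by blast
      have pk: "lead_coeff m ^ k \<in> M"
        by (induction k) (auto intro: subring_simps[OF M] lm)
      have "smult (lead_coeff m ^ Suc k) f = m * (q + smult (lead_coeff m ^ k) t) + r"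
        using k(1) unfolding f1_def
        by (simp add: smult_diff_right algebra_simps)
      moreover have "coeffs_in M (q + smult (lead_coeff m ^ k) t)"
        by (intro coeffs_in_add coeffs_in_smult M k pk t)
      ultimately show ?thesis using k by blast
    next
      case False
      then have "f1 = 0" using c by blast
      then have "smult (lead_coeff m ^ 1) f = m * t + 0" by (simp add: f1_def)
      moreover have "coeffs_in M 0" using subring_0[OF M] by (simp add: coeffs_in_def)
      ultimately show ?thesis using t by blast
    qed
  qed
qed

definition algebraic_over :: "real set \<Rightarrow> real \<Rightarrow> bool" where
  "algebraic_over M x \<longleftrightarrow> (\<exists>f. coeffs_in M f \<and> f \<noteq> 0 \<and> poly f x = 0)"

text \<open>For a subring \<open>M\<close> this is the minimal polynomial over its fraction field
  with denominators cleared, fixed only up to a scalar.\<close>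

definition minpoly :: "real set \<Rightarrow> real \<Rightarrow> real poly \<Rightarrow> bool" where
  "minpoly M x m \<longleftrightarrow> coeffs_in M m \<and> m \<noteq> 0 \<and> poly m x = 0 \<and>
    (\<forall>f. coeffs_in M f \<longrightarrow> f \<noteq> 0 \<longrightarrow> poly f x = 0 \<longrightarrow> degree m \<le> degree f)"

lemma minpoly_exists:
  assumes "algebraic_over M x" shows "\<exists>m. minpoly M x m"
  using assms ex_has_least_nat[of "\<lambda>f. coeffs_in M f \<and> f \<noteq> 0 \<and> poly f x = 0" _ degree]
  unfolding algebraic_over_def minpoly_def by metis

text \<open>The pseudo-remainder of \<open>f\<close> also vanishes at \<open>x\<close>, so
  minimality makes it zero.\<close>

lemma minpoly_divides:
  assumes M: "subring M" and m: "minpoly M x m" and f: "coeffs_in M f" "poly f x = 0"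
  shows "\<exists>k q. smult (lead_coeff m ^ k) f = m * q \<and> coeffs_in M q"
proof -
  have m': "coeffs_in M m" "m \<noteq> 0" "poly m x = 0" using m by (auto simp: minpoly_def)
  from pseudo_division[OF M m'(1,2) f(1)] obtain k q r where
    k: "smult (lead_coeff m ^ k) f = m * q + r" "coeffs_in M q" "coeffs_in M r"
       "r = 0 \<or> degree r < degree m" by blast
  have "poly (smult (lead_coeff m ^ k) f) x = poly (m * q + r) x" using k(1) by simp
  then have "poly r x = 0" using f m' by simp
  then have "r = 0" using m k unfolding minpoly_def by (meson not_le)
  then show ?thesis using k by auto
qed

lemma minpoly_degree_pos:
  assumes "minpoly M x m" shows "degree m > 0"
proof (rule ccontr)
  assume "\<not> degree m > 0"
  then obtain c where "m = [:c:]" by (metis degree_eq_zeroE gr0I)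
  then show False using assms by (auto simp: minpoly_def)
qed

text \<open>Separability in characteristic 0: the derivative is nonzero, has smaller degree and
  keeps its coefficients in \<open>M\<close>.\<close>

lemma minpoly_pderiv:
  assumes "subring M" "minpoly M x m" shows "poly (pderiv m) x \<noteq> 0"
proof
  assume a: "poly (pderiv m) x = 0"
  have d: "degree m > 0" using assms minpoly_degree_pos by blast
  then have "pderiv m \<noteq> 0" by (simp add: pderiv_eq_0_iff)
  moreover have "coeffs_in M (pderiv m)" using assms coeffs_in_pderiv by (auto simp: minpoly_def)
  ultimately have "degree m \<le> degree (pderiv m)" using a assms(2) unfolding minpoly_def by blast
  then show False using d by (simp add: degree_pderiv)
qed

text \<open>Irreducibility up to scalars. If \<open>n\<close> is minimal for \<open>y\<close>, a
  multiple of \<open>m\<close> factors as \<open>n * q\<close>. The degree of \<open>q\<close> is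
  too small for \<open>q\<close> to vanish at \<open>x\<close>, so \<open>n\<close> does, and the
  degrees of \<open>m\<close> and \<open>n\<close> agree.\<close>

lemma minpoly_root:
  assumes M: "subring M" and m: "minpoly M x m" and y: "poly m y = 0"
  shows "minpoly M y m"
proof -
  have "algebraic_over M y" using m y by (auto simp: algebraic_over_def minpoly_def)
  then obtain n where n: "minpoly M y n" using minpoly_exists by blast
  have m': "coeffs_in M m" "m \<noteq> 0" "poly m x = 0" using m by (auto simp: minpoly_def)
  have n': "coeffs_in M n" "n \<noteq> 0" "poly n y = 0" using n by (auto simp: minpoly_def)
  obtain k q where kq: "smult (lead_coeff n ^ k) m = n * q" "coeffs_in M q"
    using minpoly_divides[OF M n m'(1) y] by blast
  have nz: "lead_coeff n ^ k \<noteq> 0" using n' by simp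
  have q0: "q \<noteq> 0" using kq(1) nz m' by auto
  have deg: "degree m = degree n + degree q"
    using arg_cong[OF kq(1), of degree] nz n'(2) q0 by (simp add: degree_mult_eq)
  have "poly (smult (lead_coeff n ^ k) m) x = poly (n * q) x" using kq(1) by simp
  then have "poly n x = 0 \<or> poly q x = 0" using m' by simp
  then have "degree m \<le> degree n"
  proof
    assume "poly n x = 0"
    then show ?thesis using m n' by (auto simp: minpoly_def)
  next
    assume "poly q x = 0"
    then have "degree m \<le> degree q" using m kq q0 by (auto simp: minpoly_def)
    then show ?thesis using deg minpoly_degree_pos[OF n] by simp
  qed
  then show ?thesis using n m' y unfolding minpoly_def by (meson order_trans)
qed

section \<open>Extending derivations from subrings to all reals\<close>

definition derivation :: "(real \<Rightarrow> real) \<Rightarrow> bool" where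
  "derivation D \<longleftrightarrow> (\<forall>x y. D (x + y) = D x + D y \<and> D (x * y) = x * D y + y * D x)"

text \<open>A derivation on a subring of the reals is encoded by its graph, which is a subring of the
  dual numbers \<open>a + b \<epsilon>\<close> that meets \<open>\<real> \<epsilon>\<close> only in \<open>0\<close>.\<close>

definition derivation_graph :: "(real \<times> real) set \<Rightarrow> bool" where
  "derivation_graph \<Gamma> \<longleftrightarrow> (1, 0) \<in> \<Gamma> \<and> (\<forall>a b. (a, b) \<in> \<Gamma> \<longrightarrow> (- a, - b) \<in> \<Gamma>) \<and>
    (\<forall>a b c d. (a, b) \<in> \<Gamma> \<longrightarrow> (c, d) \<in> \<Gamma> \<longrightarrow> (a + c, b + d) \<in> \<Gamma> \<and> (a * c, a * d + b * c) \<in> \<Gamma>) \<and>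
    (\<forall>b. (0, b) \<in> \<Gamma> \<longrightarrow> b = 0)"

lemma derivation_graphD:
  assumes "derivation_graph \<Gamma>"
  shows "(1, 0) \<in> \<Gamma>" "(a, b) \<in> \<Gamma> \<Longrightarrow> (- a, - b) \<in> \<Gamma>"
    "(a, b) \<in> \<Gamma> \<Longrightarrow> (c, d) \<in> \<Gamma> \<Longrightarrow> (a + c, b + d) \<in> \<Gamma>"
    "(a, b) \<in> \<Gamma> \<Longrightarrow> (c, d) \<in> \<Gamma> \<Longrightarrow> (a * c, a * d + b * c) \<in> \<Gamma>"
    "(0, b) \<in> \<Gamma> \<Longrightarrow> b = 0"
  using assms unfolding derivation_graph_def by blast+

lemma derivation_graph_0: assumes "derivation_graph \<Gamma>" shows "(0, 0) \<in> \<Gamma>"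
  using derivation_graphD(3)[OF assms derivation_graphD(1)[OF assms]
    derivation_graphD(2)[OF assms derivation_graphD(1)[OF assms]]] by simp

lemma derivation_graph_unique:
  assumes "derivation_graph \<Gamma>" "(a, b) \<in> \<Gamma>" "(a, c) \<in> \<Gamma>" shows "b = c"
  using derivation_graphD(5)[OF assms(1), of "b - c"]
    derivation_graphD(3)[OF assms(1,2) derivation_graphD(2)[OF assms(1,3)]] by simp

lemma derivation_graph_sum:
  assumes "derivation_graph \<Gamma>" "\<And>i. i \<in> A \<Longrightarrow> (f i, g i) \<in> \<Gamma>" shows "(sum f A, sum g A) \<in> \<Gamma>"
  using assms(2)
  by (induction A rule: infinite_finite_induct)
     (auto intro: derivation_graph_0[OF assms(1)] derivation_graphD(3)[OF assms(1)])

lemma subring_fst_derivation_graph: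
  assumes "derivation_graph \<Gamma>" shows "subring (fst ` \<Gamma>)"
  unfolding subring_def
proof (intro conjI ballI)
  show "1 \<in> fst ` \<Gamma>" using derivation_graphD(1)[OF assms] by force
next
  fix a assume "a \<in> fst ` \<Gamma>"
  then obtain b where "(a, b) \<in> \<Gamma>" by auto
  then show "- a \<in> fst ` \<Gamma>" using derivation_graphD(2)[OF assms] by force
next
  fix a c assume "a \<in> fst ` \<Gamma>" "c \<in> fst ` \<Gamma>"
  then obtain b d where "(a, b) \<in> \<Gamma>" "(c, d) \<in> \<Gamma>" by auto
  then show "a + c \<in> fst ` \<Gamma>" "a * c \<in> fst ` \<Gamma>"
    using derivation_graphD(3,4)[OF assms, of a b c d] by force+
qed

text \<open>The pair stands for the polynomial f + h \<epsilon> over the dual-number ring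
  \<open>\<Gamma>\<close>; \<open>h\<close> is \<open>f\<close> with the derivation applied to each
  coefficient.\<close>

definition dual_poly :: "(real \<times> real) set \<Rightarrow> real poly \<Rightarrow> real poly \<Rightarrow> bool" where
  "dual_poly \<Gamma> f h \<longleftrightarrow> (\<forall>i. (coeff f i, coeff h i) \<in> \<Gamma>)"

lemma dual_poly_mult:
  assumes "derivation_graph \<Gamma>" "dual_poly \<Gamma> f h" "dual_poly \<Gamma> g k"
  shows "dual_poly \<Gamma> (f * g) (f * k + h * g)"
  using assms(2,3) unfolding dual_poly_def coeff_add coeff_mult sum.distrib[symmetric]
  by (auto intro!: derivation_graph_sum[OF assms(1)] derivation_graphD(4)[OF assms(1)])

lemma dual_poly_unique:
  assumes "derivation_graph \<Gamma>" "dual_poly \<Gamma> f h" "dual_poly \<Gamma> f k" shows "h = k"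
  using assms derivation_graph_unique unfolding dual_poly_def by (blast intro: poly_eqI)

lemma dual_poly_lift:
  assumes "derivation_graph \<Gamma>" "coeffs_in (fst ` \<Gamma>) f" shows "\<exists>h. dual_poly \<Gamma> f h"
proof -
  have "\<forall>i. \<exists>b. (coeff f i, b) \<in> \<Gamma>" using assms(2) by (force simp: coeffs_in_def)
  then obtain b where b: "\<And>i. (coeff f i, b i) \<in> \<Gamma>" by metis
  \<comment> \<open>Beyond the degree of \<open>f\<close> the coefficients are 0, and (0, b) lies in
    \<open>\<Gamma>\<close> only for b = 0, so the lifted sequence has finite support.\<close>
  have "coeff (Abs_poly (\<lambda>i. b i)) = b"
  proof (rule coeff_Abs_poly)
    fix i assume "i > degree f"
    then show "b i = 0" using b[of i] derivation_graphD(5)[OF assms(1)] by (simp add: coeff_eq_0)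
  qed
  then have "dual_poly \<Gamma> f (Abs_poly b)" using b by (simp add: dual_poly_def)
  then show ?thesis by blast
qed

text \<open>The values of f + h \<epsilon> at the dual number x + y \<epsilon>: the candidate
  extension of the derivation to the ring generated by \<open>x\<close>, with \<open>x\<close> sent
  to \<open>y\<close>.\<close>

definition adjoin :: "(real \<times> real) set \<Rightarrow> real \<Rightarrow> real \<Rightarrow> (real \<times> real) set" where
  "adjoin \<Gamma> x y = {(poly f x, poly h x + poly (pderiv f) x * y) | f h. dual_poly \<Gamma> f h}"

lemma adjoin_extends:
  assumes "derivation_graph \<Gamma>" shows "\<Gamma> \<subseteq> adjoin \<Gamma> x y" "(x, y) \<in> adjoin \<Gamma> x y"
proof
  fix c assume "c \<in> \<Gamma>"
  then have "dual_poly \<Gamma> [:fst c:] [:snd c:]"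
    using derivation_graph_0[OF assms] by (auto simp: dual_poly_def coeff_pCons split: nat.split)
  then show "c \<in> adjoin \<Gamma> x y" unfolding adjoin_def by force
next
  have "dual_poly \<Gamma> [:0, 1:] 0"
    using derivation_graph_0[OF assms] derivation_graphD(1)[OF assms]
    by (auto simp: dual_poly_def coeff_pCons split: nat.split)
  then show "(x, y) \<in> adjoin \<Gamma> x y" unfolding adjoin_def by (force simp: pderiv_pCons)
qed

text \<open>Evaluation at x + y \<epsilon> is a ring homomorphism, so its image is a ring;
  \<open>inj\<close> says that the extension is well defined.\<close>

lemma adjoin_derivation_graph:
  assumes \<Gamma>: "derivation_graph \<Gamma>"
    and inj: "\<And>f h. dual_poly \<Gamma> f h \<Longrightarrow> poly f x = 0 \<Longrightarrow> poly h x + poly (pderiv f) x * y = 0"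
  shows "derivation_graph (adjoin \<Gamma> x y)"
proof -
  have 1: "(1, 0) \<in> adjoin \<Gamma> x y"
    using adjoin_extends(1)[OF \<Gamma>] derivation_graphD(1)[OF \<Gamma>] by blast
  have 2: "(- a, - b) \<in> adjoin \<Gamma> x y" if "(a, b) \<in> adjoin \<Gamma> x y" for a b
  proof -
    from that obtain f h where fh: "dual_poly \<Gamma> f h" "a = poly f x" "b = poly h x + poly (pderiv f) x * y"
      by (auto simp: adjoin_def)
    have "dual_poly \<Gamma> (- f) (- h)"
      using fh(1) derivation_graphD(2)[OF \<Gamma>] by (auto simp: dual_poly_def)
    then show ?thesis unfolding adjoin_def using fh(2,3)
      by (intro CollectI exI[of _ "- f"] exI[of _ "- h"]) (simp add: pderiv_minus)
  qed
  have 3: "(a + c, b + d) \<in> adjoin \<Gamma> x y \<and> (a * c, a * d + b * c) \<in> adjoin \<Gamma> x y"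
    if "(a, b) \<in> adjoin \<Gamma> x y" "(c, d) \<in> adjoin \<Gamma> x y" for a b c d
  proof -
    from that obtain f h g k where fh: "dual_poly \<Gamma> f h" "a = poly f x" "b = poly h x + poly (pderiv f) x * y"
      "dual_poly \<Gamma> g k" "c = poly g x" "d = poly k x + poly (pderiv g) x * y"
      by (auto simp: adjoin_def)
    have "dual_poly \<Gamma> (f + g) (h + k)"
      using fh(1,4) derivation_graphD(3)[OF \<Gamma>] by (auto simp: dual_poly_def)
    then have "(a + c, b + d) \<in> adjoin \<Gamma> x y" unfolding adjoin_def using fh
      by (intro CollectI exI[of _ "f + g"] exI[of _ "h + k"]) (simp add: pderiv_add algebra_simps)
    moreover have "(a * c, a * d + b * c) \<in> adjoin \<Gamma> x y"
      unfolding adjoin_def using fh dual_poly_mult[OF \<Gamma> fh(1,4)]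
      by (intro CollectI exI[of _ "f * g"] exI[of _ "f * k + h * g"]) (simp add: pderiv_mult algebra_simps)
    ultimately show ?thesis by blast
  qed
  have 4: "b = 0" if "(0, b) \<in> adjoin \<Gamma> x y" for b
    using that inj by (auto simp: adjoin_def)
  show ?thesis unfolding derivation_graph_def using 1 2 3 4 by blast
qed

text \<open>A transcendental \<open>x\<close> may be sent to 0. For an algebraic \<open>x\<close>,
  differentiating m(x) = 0 dictates the value, and separability permits the division by
  m'(x).\<close>

lemma derivation_graph_extend:
  assumes \<Gamma>: "derivation_graph \<Gamma>"
  shows "\<exists>y. derivation_graph (adjoin \<Gamma> x y)"
proof (cases "algebraic_over (fst ` \<Gamma>) x")
  case False
  have "derivation_graph (adjoin \<Gamma> x 0)"
  proof (rule adjoin_derivation_graph[OF \<Gamma>])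
    fix f h assume fh: "dual_poly \<Gamma> f h" "poly f x = 0"
    have "coeffs_in (fst ` \<Gamma>) f" using fh(1) by (force simp: dual_poly_def coeffs_in_def)
    then have "f = 0" using False fh(2) by (auto simp: algebraic_over_def)
    then have "h = 0"
      using fh(1) dual_poly_unique[OF \<Gamma>, of 0 h 0] derivation_graph_0[OF \<Gamma>]
      by (simp add: dual_poly_def)
    then show "poly h x + poly (pderiv f) x * 0 = 0" by simp
  qed
  then show ?thesis by blast
next
  case True
  let ?M = "fst ` \<Gamma>"
  have M: "subring ?M" using subring_fst_derivation_graph[OF \<Gamma>] .
  obtain m where m: "minpoly ?M x m" using minpoly_exists[OF True] by blast
  have m': "coeffs_in ?M m" "m \<noteq> 0" "poly m x = 0" using m by (auto simp: minpoly_def)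
  obtain n where n: "dual_poly \<Gamma> m n" using dual_poly_lift[OF \<Gamma> m'(1)] by blast
  define y where "y = - poly n x / poly (pderiv m) x"
  have y: "poly n x + poly (pderiv m) x * y = 0"
    using minpoly_pderiv[OF M m] by (simp add: y_def)
  have "derivation_graph (adjoin \<Gamma> x y)"
  proof (rule adjoin_derivation_graph[OF \<Gamma>])
    fix f h assume fh: "dual_poly \<Gamma> f h" "poly f x = 0"
    have f: "coeffs_in ?M f" using fh(1) by (force simp: dual_poly_def coeffs_in_def)
    obtain k q where kq: "smult (lead_coeff m ^ k) f = m * q" "coeffs_in ?M q"
      using minpoly_divides[OF M m f fh(2)] by blast
    obtain s where s: "dual_poly \<Gamma> q s" using dual_poly_lift[OF \<Gamma> kq(2)] by blast
    \<comment> \<open>Differentiate c f = m q coefficientwise and formally, then evaluate at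
      \<open>x\<close>, where \<open>f\<close> and \<open>m\<close> vanish. The results are q(x)
      times n(x) and q(x) times m'(x), and n(x) + m'(x) y = 0 by the choice of
      \<open>y\<close>.\<close>
    let ?c = "lead_coeff m ^ k"
    have "?c \<in> ?M" using m'(1) by (induction k) (auto intro: subring_simps[OF M] simp: coeffs_in_def)
    then obtain c' where "(?c, c') \<in> \<Gamma>" by force
    then have "dual_poly \<Gamma> [:?c:] [:c':]"
      using derivation_graph_0[OF \<Gamma>] by (auto simp: dual_poly_def coeff_pCons split: nat.split)
    from dual_poly_mult[OF \<Gamma> this fh(1)]
    have "dual_poly \<Gamma> (m * q) ([:?c:] * h + [:c':] * f)" using kq(1) by simp
    with dual_poly_mult[OF \<Gamma> n s] have e: "[:?c:] * h + [:c':] * f = m * s + n * q"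
      using dual_poly_unique[OF \<Gamma>] by blast
    have e1: "?c * poly h x = poly n x * poly q x"
      using arg_cong[OF e, of "\<lambda>g. poly g x"] fh(2) m'(3) by simp
    have e2: "?c * poly (pderiv f) x = poly (pderiv m) x * poly q x"
      using arg_cong[OF kq(1), of "\<lambda>g. poly (pderiv g) x"] m'(3)
      by (simp add: pderiv_smult pderiv_mult)
    have "?c * (poly h x + poly (pderiv f) x * y) = (?c * poly h x) + (?c * poly (pderiv f) x) * y"
      by (simp add: algebra_simps)
    also have "\<dots> = poly q x * (poly n x + poly (pderiv m) x * y)"
      unfolding e1 e2 by (simp add: algebra_simps)
    finally show "poly h x + poly (pderiv f) x * y = 0" using y m'(2) by simp
  qed
  then show ?thesis by blast
qed

text \<open>The zero derivation on \<open>M\<close> extends to M[t] with \<open>t\<close> sent to 1,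
  since \<open>t\<close> satisfies no relation over \<open>M\<close>. Zorn's lemma gives a maximal
  derivation graph; by one-element extensions its domain is all of \<real>.\<close>

theorem derivation_exists:
  assumes M: "subring M" and t: "\<not> algebraic_over M t"
  shows "\<exists>D. derivation D \<and> (\<forall>c\<in>M. D c = 0) \<and> D t = 1"
proof -
  let ?A = "(\<lambda>c. (c, 0)) ` M"
  have A: "derivation_graph ?A"
    unfolding derivation_graph_def using subring_simps[OF M] by auto
  have "derivation_graph (adjoin ?A t 1)"
  proof (rule adjoin_derivation_graph[OF A])
    fix f h assume fh: "dual_poly ?A f h" "poly f t = 0"
    have "coeffs_in M f" using fh(1) by (force simp: dual_poly_def coeffs_in_def)
    then have "f = 0" using t fh(2) by (auto simp: algebraic_over_def)
    moreover have "h = 0" using fh(1) by (force simp: dual_poly_def intro: poly_eqI)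
    ultimately show "poly h t + poly (pderiv f) t * 1 = 0" by simp
  qed
  moreover have "?A \<subseteq> adjoin ?A t 1" "(t, 1) \<in> adjoin ?A t 1" using adjoin_extends[OF A] by auto
  moreover define F where "F = {\<Gamma>. derivation_graph \<Gamma> \<and> insert (t, 1) ?A \<subseteq> \<Gamma>}"
  ultimately have ne: "F \<noteq> {}" by blast
  have "\<exists>\<Gamma>\<in>F. \<forall>X\<in>F. \<Gamma> \<subseteq> X \<longrightarrow> X = \<Gamma>"
  proof (rule subset_Zorn_nonempty[OF ne])
    fix C assume C: "C \<noteq> {}" "subset.chain F C"
    have CF: "C \<subseteq> F" and tot: "\<And>X Y. X \<in> C \<Longrightarrow> Y \<in> C \<Longrightarrow> X \<subseteq> Y \<or> Y \<subseteq> X"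
      using C(2) by (auto simp: subset_chain_def)
    \<comment> \<open>Closure involves two elements at a time, and in a chain both lie in one
      member.\<close>
    have two: "\<exists>X\<in>C. a \<in> X \<and> b \<in> X" if "a \<in> \<Union>C" "b \<in> \<Union>C" for a b
      using that tot by blast
    have dg: "derivation_graph X" if "X \<in> C" for X using that CF by (auto simp: F_def)
    have "derivation_graph (\<Union>C)"
      unfolding derivation_graph_def
    proof (intro conjI allI impI)
      show "(1, 0) \<in> \<Union>C" using C(1) dg derivation_graphD(1) by blast
    next
      fix a b assume "(a, b) \<in> \<Union>C" then show "(- a, - b) \<in> \<Union>C" using dg derivation_graphD(2) by blast
    next
      fix a b c d assume "(a, b) \<in> \<Union>C" "(c, d) \<in> \<Union>C"
      then obtain X where X: "X \<in> C" "(a, b) \<in> X" "(c, d) \<in> X" using two by blast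
      show "(a + c, b + d) \<in> \<Union>C" "(a * c, a * d + b * c) \<in> \<Union>C"
        using derivation_graphD(3,4)[OF dg[OF X(1)] X(2,3)] X(1) by blast+
    next
      fix b assume "(0, b) \<in> \<Union>C" then show "b = 0" using dg derivation_graphD(5) by blast
    qed
    moreover have "insert (t, 1) ?A \<subseteq> \<Union>C" using C(1) CF by (fastforce simp: F_def)
    ultimately show "\<Union>C \<in> F" by (simp add: F_def)
  qed
  then obtain \<Gamma> where \<Gamma>: "\<Gamma> \<in> F" "\<And>X. X \<in> F \<Longrightarrow> \<Gamma> \<subseteq> X \<Longrightarrow> X = \<Gamma>" by blast
  have g: "derivation_graph \<Gamma>" and sub: "insert (t, 1) ?A \<subseteq> \<Gamma>" using \<Gamma>(1) by (auto simp: F_def)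
  have dom: "\<exists>y. (x, y) \<in> \<Gamma>" for x
  proof -
    obtain y where y: "derivation_graph (adjoin \<Gamma> x y)" using derivation_graph_extend[OF g] by blast
    then have "adjoin \<Gamma> x y = \<Gamma>" using \<Gamma>(2) adjoin_extends(1)[OF g] sub by (simp add: F_def) blast
    then show ?thesis using adjoin_extends(2)[OF g] by blast
  qed
  define D where "D x = (SOME y. (x, y) \<in> \<Gamma>)" for x
  have D: "(x, D x) \<in> \<Gamma>" for x unfolding D_def using dom by (rule someI_ex)
  have eq: "D x = y" if "(x, y) \<in> \<Gamma>" for x y using derivation_graph_unique[OF g D that] .
  have "derivation D" unfolding derivation_def
    using eq derivation_graphD(3,4)[OF g D D] by (simp add: algebra_simps)
  moreover have "D c = 0" if "c \<in> M" for c using that sub by (intro eq) auto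
  moreover have "D t = 1" using sub by (intro eq) auto
  ultimately show ?thesis by blast
qed

section \<open>Calculus of derivations\<close>

lemma derivation_add: "derivation D \<Longrightarrow> D (x + y) = D x + D y"
  by (simp add: derivation_def)

lemma derivation_mult: "derivation D \<Longrightarrow> D (x * y) = x * D y + y * D x"
  by (simp add: derivation_def)

lemma derivation_0: "derivation D \<Longrightarrow> D 0 = 0"
  using derivation_add[of D 0 0] by simp

lemma derivation_1: "derivation D \<Longrightarrow> D 1 = 0"
  using derivation_mult[of D 1 1] by simp

lemma derivation_diff: "derivation D \<Longrightarrow> D (x - y) = D x - D y"
  using derivation_add[of D "x - y" y] by simp

lemma derivation_uminus: "derivation D \<Longrightarrow> D (- x) = - D x"
  using derivation_diff[of D 0 x] by (simp add: derivation_0)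

lemma derivation_sum: "derivation D \<Longrightarrow> D (sum f A) = (\<Sum>i\<in>A. D (f i))"
  by (induction A rule: infinite_finite_induct) (simp_all add: derivation_0 derivation_add)

lemma derivation_of_nat: "derivation D \<Longrightarrow> D (of_nat n) = 0"
  by (induction n) (simp_all add: derivation_0 derivation_1 derivation_add)

lemma derivation_of_int: "derivation D \<Longrightarrow> D (of_int n) = 0"
  by (cases n rule: int_cases2) (auto simp: derivation_of_nat derivation_uminus)

lemma derivation_of_rat: assumes D: "derivation D" shows "D (of_rat r) = 0"
proof -
  obtain a b where r: "r = Fract a b" "b > 0" by (cases r) auto
  have "of_int b * (of_rat r :: real) = of_int a" using r by (simp add: of_rat_rat)
  then have "D (of_int b * of_rat r) = 0" using derivation_of_int[OF D] by simp
  then have "of_int b * D (of_rat r) = 0" using derivation_of_int[OF D] by (simp add: derivation_mult[OF D])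
  then show ?thesis using r by simp
qed

lemma derivation_poly:
  assumes D: "derivation D"
  shows "D (poly f x) = poly (map_poly D f) x + poly (pderiv f) x * D x"
proof (induction f)
  case 0 then show ?case by (simp add: derivation_0[OF D])
next
  case (pCons a f)
  have "D (a + x * poly f x) = D a + (x * D (poly f x) + poly f x * D x)"
    by (simp add: derivation_add[OF D] derivation_mult[OF D])
  then show ?case using pCons
    by (simp add: map_poly_pCons derivation_0[OF D] pderiv_pCons algebra_simps)
qed

text \<open>Differentiating the minimal polynomial relation leaves m'(x) D x = 0, because
  \<open>D\<close> kills the coefficients.\<close>

lemma derivation_algebraic:
  assumes D: "derivation D" and M: "subring M" "\<And>c. c \<in> M \<Longrightarrow> D c = 0" and x: "algebraic_over M x"
  shows "D x = 0"
proof -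
  obtain m where m: "minpoly M x m" using minpoly_exists[OF x] by blast
  have "coeff (map_poly D m) i = 0" for i
    using m M(2) by (simp add: coeff_map_poly derivation_0[OF D] minpoly_def coeffs_in_def)
  then have "map_poly D m = 0" by (simp add: poly_eq_iff)
  then have "poly (pderiv m) x * D x = 0"
    using derivation_poly[OF D, of m x] m derivation_0[OF D] by (simp add: minpoly_def)
  then show ?thesis using minpoly_pderiv[OF M(1) m] by simp
qed

section \<open>Polynomial functions at generic points\<close>

text \<open>Polynomials in the members of \<open>S\<close> over the rationals, taken as functions so
  that one \<open>F\<close> can be evaluated at \<open>p\<close>, at \<open>q\<close> and along
  deformations. The values at \<open>p\<close> form the ring over which algebraicity is
  measured.\<close>

inductive_set polyfun :: "('c \<Rightarrow> real) set \<Rightarrow> ('c \<Rightarrow> real) set" for S where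
  const: "(\<lambda>_. of_rat c) \<in> polyfun S"
| gen: "F \<in> S \<Longrightarrow> F \<in> polyfun S"
| add: "F \<in> polyfun S \<Longrightarrow> H \<in> polyfun S \<Longrightarrow> (\<lambda>r. F r + H r) \<in> polyfun S"
| mult: "F \<in> polyfun S \<Longrightarrow> H \<in> polyfun S \<Longrightarrow> (\<lambda>r. F r * H r) \<in> polyfun S"

lemma polyfun_minimal:
  assumes "S \<subseteq> polyfun T" shows "polyfun S \<subseteq> polyfun T"
proof
  fix F assume "F \<in> polyfun S"
  then show "F \<in> polyfun T" using assms by induction (auto intro: polyfun.intros)
qed

lemma polyfun_uminus: "F \<in> polyfun S \<Longrightarrow> (\<lambda>r. - F r) \<in> polyfun S"
  using polyfun.mult[OF polyfun.const[of "- 1"], of F S] by (simp add: of_rat_minus)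

lemma polyfun_diff: "F \<in> polyfun S \<Longrightarrow> H \<in> polyfun S \<Longrightarrow> (\<lambda>r. F r - H r) \<in> polyfun S"
  using polyfun.add[OF _ polyfun_uminus, of F S H] by simp

lemma polyfun_sum:
  assumes "\<And>i. i \<in> A \<Longrightarrow> F i \<in> polyfun S" shows "(\<lambda>r. \<Sum>i\<in>A. F i r) \<in> polyfun S"
  using assms
proof (induction A rule: infinite_finite_induct)
  case (insert x A)
  then show ?case using polyfun.add[of "F x" S "\<lambda>r. \<Sum>i\<in>A. F i r"] by simp
qed (use polyfun.const[of 0 S] in auto)

lemma polyfun_power: "F \<in> polyfun S \<Longrightarrow> (\<lambda>r. F r ^ n) \<in> polyfun S"
proof (induction n)
  case 0 then show ?case using polyfun.const[of 1 S] by simp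
next
  case (Suc n) then show ?case using polyfun.mult[of F S "\<lambda>r. F r ^ n"] by simp
qed

lemma subring_polyfun_values: "subring ((\<lambda>F. F p) ` polyfun S)"
  unfolding subring_def
proof (intro conjI ballI)
  show "1 \<in> (\<lambda>F. F p) ` polyfun S" using polyfun.const[of 1 S] by force
next
  fix a assume "a \<in> (\<lambda>F. F p) ` polyfun S"
  then show "- a \<in> (\<lambda>F. F p) ` polyfun S" using polyfun_uminus by force
next
  fix a b assume "a \<in> (\<lambda>F. F p) ` polyfun S" "b \<in> (\<lambda>F. F p) ` polyfun S"
  then obtain F H where "F \<in> polyfun S" "H \<in> polyfun S" "a = F p" "b = H p" by auto
  then show "a + b \<in> (\<lambda>F. F p) ` polyfun S" "a * b \<in> (\<lambda>F. F p) ` polyfun S"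
    using polyfun.add[of F S H] polyfun.mult[of F S H] by force+
qed

lemma coeffs_in_polyfun_values:
  assumes "coeffs_in ((\<lambda>F. F p) ` polyfun S) f"
  obtains F where "\<And>i. F i \<in> polyfun S" "\<And>i. coeff f i = F i p"
proof -
  have "\<forall>i. \<exists>F. F \<in> polyfun S \<and> coeff f i = F p" using assms by (auto simp: coeffs_in_def)
  then show ?thesis using that by metis
qed

section \<open>Evaluation of formal polynomials over the rationals\<close>

lemma poly_mapping_add_single_induct:
  assumes "P 0" "\<And>f a b. P f \<Longrightarrow> P (f + Poly_Mapping.single a b)"
  shows "P (f :: 'a \<Rightarrow>\<^sub>0 'b::monoid_add)"
proof (induction f rule: update_induct)
  case const then show ?case using assms(1) .
next
  case (update f a b)
  have "Poly_Mapping.update a b f = f + Poly_Mapping.single a b"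
    using update(1) by (intro poly_mapping_eqI)
      (auto simp: lookup_update lookup_add lookup_single when_def in_keys_iff)
  then show ?case using assms(2) update by simp
qed

definition monomial_eval :: "('i \<Rightarrow> real) \<Rightarrow> ('i \<Rightarrow>\<^sub>0 nat) \<Rightarrow> real" where
  "monomial_eval x m = (\<Prod>i\<in>Poly_Mapping.keys m. x i ^ Poly_Mapping.lookup m i)"

lemma monomial_eval_superset:
  assumes "finite A" "Poly_Mapping.keys m \<subseteq> A"
  shows "monomial_eval x m = (\<Prod>i\<in>A. x i ^ Poly_Mapping.lookup m i)"
  unfolding monomial_eval_def using assms
  by (intro prod.mono_neutral_left) (auto simp: in_keys_iff)

lemma monomial_eval_add: "monomial_eval x (m + n) = monomial_eval x m * monomial_eval x n"
proof -
  let ?A = "Poly_Mapping.keys m \<union> Poly_Mapping.keys n"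
  have "monomial_eval x (m + n) = (\<Prod>i\<in>?A. x i ^ Poly_Mapping.lookup (m + n) i)"
    using keys_add[of m n] by (intro monomial_eval_superset) auto
  also have "\<dots> = (\<Prod>i\<in>?A. x i ^ Poly_Mapping.lookup m i) * (\<Prod>i\<in>?A. x i ^ Poly_Mapping.lookup n i)"
    by (simp add: lookup_add power_add prod.distrib)
  finally show ?thesis using monomial_eval_superset[of ?A] by simp
qed

lemma mpoly_eval_monomial_eval:
  "mpoly_eval x f = (\<Sum>m\<in>Poly_Mapping.keys f. of_rat (Poly_Mapping.lookup f m) * monomial_eval x m)"
  by (simp add: mpoly_eval_def monomial_eval_def)

lemma mpoly_eval_0: "mpoly_eval x 0 = 0"
  by (simp add: mpoly_eval_def)

lemma mpoly_eval_add: "mpoly_eval x (f + g) = mpoly_eval x f + mpoly_eval x g"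
  unfolding mpoly_eval_monomial_eval
  by (rule setsum_keys_plus_distrib) (auto simp: of_rat_add algebra_simps)

lemma mpoly_eval_single: "mpoly_eval x (Poly_Mapping.single m c) = of_rat c * monomial_eval x m"
  by (simp add: mpoly_eval_monomial_eval)

lemma mpoly_eval_mult: "mpoly_eval x (f * g) = mpoly_eval x f * mpoly_eval x g"
proof (induction f rule: poly_mapping_add_single_induct)
  case 1 then show ?case by (simp add: mpoly_eval_0)
next
  case (2 f a b)
  have "mpoly_eval x (Poly_Mapping.single a b * g) = of_rat b * monomial_eval x a * mpoly_eval x g"
  proof (induction g rule: poly_mapping_add_single_induct)
    case 1 then show ?case by (simp add: mpoly_eval_0)
  next
    case (2 g c d)
    then show ?case
      by (simp add: distrib_left mpoly_eval_add mult_single mpoly_eval_single monomial_eval_add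
          of_rat_mult)
  qed
  then show ?case using 2 by (simp add: distrib_right mpoly_eval_add mpoly_eval_single)
qed

definition coords :: "('v \<times> 'd) set \<Rightarrow> (('v \<Rightarrow> real ^ 'd) \<Rightarrow> real) set" where
  "coords I = (\<lambda>(w, i) r. r w $ i) ` I"

text \<open>Bridge to the formal polynomials in the definition of genericity; a single
  \<open>f\<close> serves all frameworks \<open>r\<close>.\<close>

lemma polyfun_coords_mpoly:
  fixes F :: "('v \<Rightarrow> real ^ 'd) \<Rightarrow> real"
  assumes "F \<in> polyfun (coords I)"
  shows "\<exists>f. (\<forall>m\<in>Poly_Mapping.keys f. Poly_Mapping.keys m \<subseteq> I) \<and>
    (\<forall>r. F r = mpoly_eval (\<lambda>(w, i). r w $ i) f)"
  using assms
proof induction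
  case (const c)
  show ?case
    by (intro exI[of _ "Poly_Mapping.single 0 c"])
      (auto simp: mpoly_eval_single monomial_eval_def split: if_splits)
next
  case (gen F)
  then obtain w i where "F = (\<lambda>r. r w $ i)" "(w, i) \<in> I" by (auto simp: coords_def)
  then show ?case
    by (intro exI[of _ "Poly_Mapping.single (Poly_Mapping.single (w, i) 1) 1"])
      (auto simp: mpoly_eval_single monomial_eval_def split: if_splits)
next
  case (add F H)
  then obtain f h where f: "\<forall>m\<in>Poly_Mapping.keys f. Poly_Mapping.keys m \<subseteq> I"
      "\<forall>r. F r = mpoly_eval (\<lambda>(w, i). r w $ i) f"
    and h: "\<forall>m\<in>Poly_Mapping.keys h. Poly_Mapping.keys m \<subseteq> I"
      "\<forall>r. H r = mpoly_eval (\<lambda>(w, i). r w $ i) h" by blast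
  have "\<forall>m\<in>Poly_Mapping.keys (f + h). Poly_Mapping.keys m \<subseteq> I"
    using f(1) h(1) keys_add[of f h] by blast
  then show ?case using f(2) h(2)
    by (intro exI[of _ "f + h"]) (simp add: mpoly_eval_add)
next
  case (mult F H)
  then obtain f h where f: "\<forall>m\<in>Poly_Mapping.keys f. Poly_Mapping.keys m \<subseteq> I"
      "\<forall>r. F r = mpoly_eval (\<lambda>(w, i). r w $ i) f"
    and h: "\<forall>m\<in>Poly_Mapping.keys h. Poly_Mapping.keys m \<subseteq> I"
      "\<forall>r. H r = mpoly_eval (\<lambda>(w, i). r w $ i) h" by blast
  have "Poly_Mapping.keys m \<subseteq> I" if m: "m \<in> Poly_Mapping.keys (f * h)" for m
  proof -
    obtain a b where "m = a + b" "a \<in> Poly_Mapping.keys f" "b \<in> Poly_Mapping.keys h"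
      using keys_mult[of f h] m by blast
    then show ?thesis using f(1) h(1) keys_add[of a b] by blast
  qed
  then show ?case using f(2) h(2)
    by (intro exI[of _ "f * h"]) (auto simp: mpoly_eval_mult)
qed

section \<open>Algebraic relations at generic frameworks\<close>

abbreviation independent_coords :: "('v \<times> 'd) set \<Rightarrow> ('v \<Rightarrow> real ^ 'd) \<Rightarrow> bool" where
  "independent_coords I p \<equiv> alg_independent_over_rat I (\<lambda>(w, i). p w $ i)"

text \<open>Independence makes the formal polynomial behind \<open>F\<close> zero, so a relation at
  one generic framework holds at every framework.\<close>

lemma polyfun_vanishes:
  assumes p: "independent_coords I p" and F: "F \<in> polyfun (coords I)" "F p = 0"
  shows "F r = 0"
proof -
  obtain f where f: "\<forall>m\<in>Poly_Mapping.keys f. Poly_Mapping.keys m \<subseteq> I"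
    "\<forall>r. F r = mpoly_eval (\<lambda>(w, i). r w $ i) f"
    using polyfun_coords_mpoly[OF F(1)] by blast
  then have "f = 0" using p F(2) unfolding alg_independent_over_rat_def by auto
  then show ?thesis using f(2) by (simp add: mpoly_eval_0)
qed

lemma polyfun_coords_cong:
  assumes "F \<in> polyfun (coords I)" "\<And>w i. (w, i) \<in> I \<Longrightarrow> r w $ i = s w $ i"
  shows "F r = F s"
  using assms(1) by induction (use assms(2) in \<open>auto simp: coords_def\<close>)

lemma coords_mono:
  assumes "I \<subseteq> J" shows "polyfun (coords I) \<subseteq> polyfun (coords J)"
proof (rule polyfun_minimal)
  have "coords I \<subseteq> coords J" unfolding coords_def using assms by (rule image_mono)
  then show "coords I \<subseteq> polyfun (coords J)" by (blast intro: polyfun.gen)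
qed

text \<open>A relation makes \<open>H\<close> vanish at \<open>p\<close>, hence everywhere. Moving
  only the coordinate (z, i) of \<open>p\<close> leaves the coefficients fixed, so every real number
  would be a root of \<open>f\<close>.\<close>

lemma generic_coord_not_algebraic:
  fixes p :: "'v \<Rightarrow> real ^ 'd"
  assumes p: "independent_coords I p" and zi: "(z, i) \<in> I"
  shows "\<not> algebraic_over ((\<lambda>F. F p) ` polyfun (coords (I - {(z, i)}))) (p z $ i)"
proof
  assume "algebraic_over ((\<lambda>F. F p) ` polyfun (coords (I - {(z, i)}))) (p z $ i)"
  then obtain f where f: "coeffs_in ((\<lambda>F. F p) ` polyfun (coords (I - {(z, i)}))) f" "f \<noteq> 0"
    "poly f (p z $ i) = 0" by (auto simp: algebraic_over_def)
  obtain F where F: "\<And>k. F k \<in> polyfun (coords (I - {(z, i)}))" "\<And>k. coeff f k = F k p"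
    using coeffs_in_polyfun_values[OF f(1)] by blast
  define H where "H r = (\<Sum>k\<le>degree f. F k r * (r z $ i) ^ k)" for r :: "'v \<Rightarrow> real ^ 'd"
  have F': "F k \<in> polyfun (coords I)" for k
    using F(1)[of k] coords_mono[of "I - {(z, i)}" I] by blast
  have g: "(\<lambda>r. r z $ i) \<in> polyfun (coords I)"
    using zi by (intro polyfun.gen) (auto simp: coords_def)
  have H: "H \<in> polyfun (coords I)"
    unfolding H_def by (intro polyfun_sum polyfun.mult polyfun_power F' g)
  have Hp: "H p = 0" using f(3) F(2) by (simp add: H_def poly_altdef)
  have "poly f t = 0" for t
  proof -
    define r where "r = p(z := (\<chi> j. if j = i then t else p z $ j))"
    have "F k r = F k p" for k
      by (rule polyfun_coords_cong[OF F(1)]) (auto simp: r_def)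
    then have "H r = poly f t" using F(2) by (simp add: H_def poly_altdef r_def)
    then show ?thesis using polyfun_vanishes[OF p H Hp, of r] by simp
  qed
  then have "f = 0" using poly_all_0_iff_0 by blast
  then show False using f(2) by simp
qed

text \<open>Ordered pairs are used for edges, so every edge of a graph occurs in both orientations.\<close>

definition sqlens :: "('v \<times> 'v) set \<Rightarrow> (('v \<Rightarrow> real ^ 'd::finite) \<Rightarrow> real) set" where
  "sqlens E = (\<lambda>(x, y) r. (norm (r x - r y))\<^sup>2) ` E"

lemma norm_vec_square: "(norm (a :: real ^ 'd::finite))\<^sup>2 = (\<Sum>i\<in>UNIV. (a $ i)\<^sup>2)"
  unfolding power2_norm_eq_inner by (simp add: inner_vec_def power2_eq_square)

lemma sqlen_polyfun:
  fixes x y :: 'v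
  assumes "x \<in> W" "y \<in> W"
  shows "(\<lambda>r. (norm (r x - r y :: real ^ 'd::finite))\<^sup>2) \<in> polyfun (coords (W \<times> UNIV))"
  unfolding norm_vec_square vector_minus_component
  using assms by (intro polyfun_sum polyfun_power polyfun_diff polyfun.gen) (auto simp: coords_def)

lemma sqlens_polyfun:
  assumes "E \<subseteq> W \<times> W" shows "polyfun (sqlens E) \<subseteq> polyfun (coords (W \<times> UNIV))"
  using assms by (intro polyfun_minimal) (auto simp: sqlens_def intro!: sqlen_polyfun)

lemma polyfun_sqlens_cong:
  assumes "F \<in> polyfun (sqlens E)" "\<forall>(x, y)\<in>E. norm (r x - r y) = norm (s x - s y)"
  shows "F r = F s"
  using assms(1) by induction (use assms(2) in \<open>auto simp: sqlens_def\<close>)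

lemma poly_relation_polyfun:
  assumes p: "independent_coords I p" and F: "\<And>k. F k \<in> polyfun (coords I)" and g: "g \<in> polyfun (coords I)"
    and f: "\<And>k. coeff f k = F k p" "poly f (g p) = 0"
  shows "(\<Sum>k\<le>degree f. F k r * g r ^ k) = 0"
proof -
  have "(\<lambda>r. \<Sum>k\<le>degree f. F k r * g r ^ k) \<in> polyfun (coords I)"
    by (intro polyfun_sum polyfun.mult polyfun_power F g)
  from polyfun_vanishes[OF p this, of r] show ?thesis using f by (simp add: poly_altdef)
qed

text \<open>The rank is taken at one selected generic framework, so algebraicity found there has to
  be carried to a given one. A coefficient function that is nonzero at \<open>q\<close> cannot
  vanish at \<open>p\<close>, and conversely.\<close>

lemma algebraic_over_generic_transfer:
  assumes p: "independent_coords I p" and q: "independent_coords I q"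
    and S: "polyfun S \<subseteq> polyfun (coords I)" and g: "g \<in> polyfun (coords I)"
    and alg: "algebraic_over ((\<lambda>F. F q) ` polyfun S) (g q)"
  shows "algebraic_over ((\<lambda>F. F p) ` polyfun S) (g p)"
proof -
  obtain f where f: "coeffs_in ((\<lambda>F. F q) ` polyfun S) f" "f \<noteq> 0" "poly f (g q) = 0"
    using alg by (auto simp: algebraic_over_def)
  obtain F where F: "\<And>k. F k \<in> polyfun S" "\<And>k. coeff f k = F k q"
    using coeffs_in_polyfun_values[OF f(1)] by blast
  have F': "F k \<in> polyfun (coords I)" for k using F(1) S by blast
  have high: "F k p = 0" if "k > degree f" for k
  proof (rule polyfun_vanishes[OF q F'])
    show "F k q = 0" using F(2)[of k] that by (simp add: coeff_eq_0)
  qed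
  then have c: "coeff (Abs_poly (\<lambda>k. F k p)) = (\<lambda>k. F k p)" by (rule coeff_Abs_poly)
  define h where "h = Abs_poly (\<lambda>k. F k p)"
  have h: "coeff h k = F k p" for k using c by (simp add: h_def)
  have "coeffs_in ((\<lambda>F. F p) ` polyfun S) h" using F(1) by (auto simp: coeffs_in_def h)
  moreover have "h \<noteq> 0"
  proof
    assume "h = 0"
    then have "F (degree f) p = 0" using h by (metis coeff_0)
    then have "F (degree f) q = 0" by (rule polyfun_vanishes[OF p F'])
    then have "lead_coeff f = 0" using F(2) by simp
    then show False using f(2) by simp
  qed
  moreover have "poly h (g p) = 0"
  proof -
    have "degree h \<le> degree f" using high h by (intro degree_le) auto
    then have "poly h (g p) = (\<Sum>k\<le>degree f. F k p * g p ^ k)"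
      unfolding poly_altdef h[symmetric]
      by (intro sum.mono_neutral_left) (auto simp: coeff_eq_0)
    then show ?thesis using poly_relation_polyfun[OF q F' g F(2) f(3)] by simp
  qed
  ultimately show ?thesis by (auto simp: algebraic_over_def)
qed

text \<open>Applying \<open>D\<close> to all coordinates gives velocities; \<open>D\<close> of a
  squared length is its first-order change under them.\<close>

lemma derivation_norm_square:
  fixes a b :: "real ^ 'd::finite"
  assumes D: "derivation D"
  shows "D ((norm (a - b))\<^sup>2) = 2 * ((a - b) \<bullet> ((\<chi> i. D (a $ i)) - (\<chi> i. D (b $ i))))"
proof -
  have "(norm (a - b))\<^sup>2 = (\<Sum>i\<in>UNIV. (a $ i - b $ i) * (a $ i - b $ i))"
    unfolding norm_vec_square by (simp add: power2_eq_square)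
  then have "D ((norm (a - b))\<^sup>2) = (\<Sum>i\<in>UNIV. 2 * ((a $ i - b $ i) * (D (a $ i) - D (b $ i))))"
    by (simp only: derivation_sum[OF D] derivation_mult[OF D] derivation_diff[OF D] mult_2)
  then show ?thesis by (simp add: inner_vec_def sum_distrib_left)
qed

section \<open>Linked pairs have algebraic distance\<close>

lemma (in vector_space) dim_insert_eq_imp_span:
  assumes "finite S" "dim (insert a S) = dim S" shows "a \<in> span S"
proof (rule ccontr)
  assume a: "a \<notin> span S"
  obtain B where B: "B \<subseteq> S" "independent B" "S \<subseteq> span B" "card B = dim S" using basis_exists .
  have fin: "finite B" using B(1) assms(1) finite_subset by blast
  have "span S \<subseteq> span B" using B(3) span_minimal subspace_span by blast
  moreover have "span B \<subseteq> span S" using B(1) span_mono by blast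
  ultimately have aB: "a \<notin> span B" using a by blast
  then have "independent (insert a B)" using B(2) independent_insertI by blast
  moreover have "insert a S \<subseteq> span (insert a B)"
    using B(3) span_mono[of B "insert a B"] span_base[of a "insert a B"] by blast
  moreover have "insert a B \<subseteq> insert a S" using B(1) by blast
  ultimately have "card (insert a B) = dim (insert a S)" by (intro basis_card_eq_dim)
  moreover have "a \<notin> B" using aB span_base by blast
  ultimately show False using assms(2) B(4) fin by simp
qed

definition arcs :: "'v graph \<Rightarrow> ('v \<times> 'v) set" where
  "arcs H = {(x, y). {x, y} \<in> edges H}"

lemma arcs_subset: "finite_simple_graph H \<Longrightarrow> arcs H \<subseteq> verts H \<times> verts H"
  unfolding arcs_def finite_simple_graph_def by blast

lemma finite_arcs: "finite_simple_graph H \<Longrightarrow> finite (arcs H)"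
  using arcs_subset by (metis finite_SigmaI finite_simple_graph_def finite_subset)

lemma rigidity_row_pairing:
  fixes p m :: "'v \<Rightarrow> real ^ 'd::finite"
  assumes "finite W" "x \<in> W" "y \<in> W" "x \<noteq> y"
  shows "(\<Sum>w\<in>W. \<Sum>i\<in>UNIV. rigidity_matrix p {x, y} (w, i) * m w $ i) = (p x - p y) \<bullet> (m x - m y)"
proof -
  have "(\<Sum>i\<in>UNIV. rigidity_matrix p {x, y} (w, i) * m w $ i) =
      (if w = x then (p x - p y) \<bullet> m x else 0) + (if w = y then (p y - p x) \<bullet> m y else 0)" for w
    using assms(4) unfolding rigidity_matrix_edge[OF assms(4)] by (auto simp: inner_vec_def)
  then show ?thesis
    using assms by (simp add: sum.distrib inner_diff_left inner_diff_right)
qed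

text \<open>Pairing with \<open>m\<close> is a linear functional that kills the rows of
  \<open>H\<close>. Equal ranks put the row of \<open>{u, v}\<close> into their span.\<close>

lemma span_rigidity_rows_motion:
  fixes p m :: "'v \<Rightarrow> real ^ 'd::finite"
  assumes H: "finite_simple_graph H" and uv: "u \<in> verts H" "v \<in> verts H" "u \<noteq> v"
    and rank: "rigidity_matrix_rank (add_edge H u v) p = rigidity_matrix_rank H p"
    and m: "\<And>x y. (x, y) \<in> arcs H \<Longrightarrow> (p x - p y) \<bullet> (m x - m y) = 0"
  shows "(p u - p v) \<bullet> (m u - m v) = 0"
proof -
  interpret vs: vector_space "row_scale :: real \<Rightarrow> ('v \<times> 'd \<Rightarrow> real) \<Rightarrow> _"
    by (rule vector_space_row_scale)
  define R where "R = rigidity_matrix p ` edges H"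
  have W: "finite (verts H)" using H by (simp add: finite_simple_graph_def)
  have "edges H \<subseteq> Pow (verts H)" using H by (auto simp: finite_simple_graph_def)
  then have "finite R" unfolding R_def using W by (meson finite_Pow_iff finite_imageI finite_subset)
  moreover have "vs.dim (insert (rigidity_matrix p {u, v}) R) = vs.dim R"
    using rank by (simp add: rigidity_matrix_rank_def add_edge_def R_def)
  ultimately have sp: "rigidity_matrix p {u, v} \<in> vs.span R" by (rule vs.dim_insert_eq_imp_span)
  define \<phi> where "\<phi> r = (\<Sum>w\<in>verts H. \<Sum>i\<in>UNIV. r (w, i) * m w $ i)" for r :: "'v \<times> 'd \<Rightarrow> real"
  have "vs.subspace {r. \<phi> r = 0}"
    unfolding vs.subspace_def \<phi>_def
    by (simp add: row_scale_def algebra_simps sum.distrib sum_distrib_left[symmetric])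
  moreover have "R \<subseteq> {r. \<phi> r = 0}"
  proof
    fix r assume "r \<in> R"
    then obtain e where e: "e \<in> edges H" "r = rigidity_matrix p e" by (auto simp: R_def)
    then have "card e = 2" "e \<subseteq> verts H" using H by (auto simp: finite_simple_graph_def)
    then obtain x y where xy: "e = {x, y}" "x \<noteq> y" by (auto simp: card_2_iff)
    then have "(x, y) \<in> arcs H" using e by (simp add: arcs_def)
    then show "r \<in> {r. \<phi> r = 0}"
      using rigidity_row_pairing[OF W, of x y p m] m xy \<open>e \<subseteq> verts H\<close> e(2) by (simp add: \<phi>_def)
  qed
  ultimately have "vs.span R \<subseteq> {r. \<phi> r = 0}" by (rule vs.span_minimal[rotated])
  then show ?thesis using sp rigidity_row_pairing[OF W uv, of p m] by (auto simp: \<phi>_def)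
qed

lemma linked_imp_algebraic:
  fixes p :: "'v \<Rightarrow> real ^ 'd::finite"
  assumes H: "finite_simple_graph H" and uv: "u \<in> verts H" "v \<in> verts H" "u \<noteq> v"
    and p: "generic H p" and l: "linked TYPE('d) H u v"
  shows "algebraic_over ((\<lambda>F. F p) ` polyfun (sqlens (arcs H))) ((norm (p u - p v))\<^sup>2)"
proof -
  define s where "s = (SOME s :: 'v \<Rightarrow> real ^ 'd. generic H s)"
  have s: "generic H s" unfolding s_def using someI[of "generic H" p] p by simp
  \<comment> \<open>Genericity depends only on the vertex set, so both ranks in
    \<open>linked\<close> are computed at the same framework \<open>s\<close>.\<close>
  have "generic (add_edge H u v) = (generic H :: ('v \<Rightarrow> real ^ 'd) \<Rightarrow> bool)"
    by (simp add: fun_eq_iff generic_def add_edge_def)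
  then have rank: "rigidity_matrix_rank (add_edge H u v) s = rigidity_matrix_rank H s"
    using l by (simp add: linked_def rigidity_rank_def s_def)
  have "algebraic_over ((\<lambda>F. F s) ` polyfun (sqlens (arcs H))) ((norm (s u - s v))\<^sup>2)"
  proof (rule ccontr)
    assume "\<not> ?thesis"
    then obtain D where D: "derivation D" "\<And>c. c \<in> (\<lambda>F. F s) ` polyfun (sqlens (arcs H)) \<Longrightarrow> D c = 0"
      "D ((norm (s u - s v))\<^sup>2) = 1"
      using derivation_exists[OF subring_polyfun_values] by metis
    define m :: "'v \<Rightarrow> real ^ 'd" where "m w = (\<chi> i. D (s w $ i))" for w
    have "(s x - s y) \<bullet> (m x - m y) = 0" if "(x, y) \<in> arcs H" for x y
    proof -
      have "(\<lambda>r. (norm (r x - r y))\<^sup>2) \<in> polyfun (sqlens (arcs H))"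
        using that by (intro polyfun.gen) (auto simp: sqlens_def)
      then have "D ((norm (s x - s y))\<^sup>2) = 0" using D(2) by blast
      then show ?thesis using derivation_norm_square[OF D(1), of "s x" "s y"] by (simp add: m_def)
    qed
    then have "(s u - s v) \<bullet> (m u - m v) = 0" by (rule span_rigidity_rows_motion[OF H uv rank])
    then show False using derivation_norm_square[OF D(1), of "s u" "s v"] D(3) by (simp add: m_def)
  qed
  then show ?thesis
    using algebraic_over_generic_transfer[of "verts H \<times> UNIV" p s "sqlens (arcs H)" "\<lambda>r. (norm (r u - r v))\<^sup>2"]
      p s sqlens_polyfun[OF arcs_subset[OF H]] sqlen_polyfun[OF uv(1,2)]
    by (simp add: generic_def)
qed

section \<open>Stresses of equivalent frameworks\<close>

lemma norm_square_line_derivative: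
  fixes a b c d :: "'a::real_inner"
  shows "((\<lambda>t. (norm ((a + t *\<^sub>R c) - (b + t *\<^sub>R d)))\<^sup>2) has_real_derivative
    2 * ((a - b) \<bullet> (c - d))) (at 0)"
proof -
  have square: "(norm (x + t *\<^sub>R y))\<^sup>2 = x \<bullet> x + 2 * (x \<bullet> y) * t + (y \<bullet> y) * t\<^sup>2" for x y :: 'a and t
    unfolding power2_norm_eq_inner
    by (simp add: inner_add_left inner_add_right inner_commute power2_eq_square algebra_simps)
  have "(a + t *\<^sub>R c) - (b + t *\<^sub>R d) = (a - b) + t *\<^sub>R (c - d)" for t
    by (simp add: algebra_simps)
  then have "(norm ((a + t *\<^sub>R c) - (b + t *\<^sub>R d)))\<^sup>2 =
      (a - b) \<bullet> (a - b) + 2 * ((a - b) \<bullet> (c - d)) * t + ((c - d) \<bullet> (c - d)) * t\<^sup>2" for t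
    by (simp only: square)
  then show ?thesis by (auto intro!: derivative_eq_intros)
qed

text \<open>The same coefficients serve the analytic gradient at \<open>q\<close> and the algebraic differential at \<open>p\<close>.
  No smoothness of \<open>q\<close> as a function of \<open>p\<close> is needed, and \<open>q\<close> may be far from generic.\<close>

definition length_gradient :: "('v \<times> 'v) set \<Rightarrow> ('v \<Rightarrow> real ^ 'd::finite) \<Rightarrow> ('v \<Rightarrow> real ^ 'd) \<Rightarrow>
    (('v \<Rightarrow> real ^ 'd) \<Rightarrow> real) \<Rightarrow> ('v \<times> 'v \<Rightarrow> real) \<Rightarrow> bool" where
  "length_gradient E p q F k \<longleftrightarrow>
    (\<forall>m. ((\<lambda>t. F (\<lambda>w. q w + t *\<^sub>R m w)) has_real_derivative
      (\<Sum>(x, y)\<in>E. k (x, y) * (2 * ((q x - q y) \<bullet> (m x - m y))))) (at 0)) \<and>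
    (\<forall>D. derivation D \<longrightarrow> D (F p) = (\<Sum>(x, y)\<in>E. k (x, y) * D ((norm (p x - p y))\<^sup>2)))"

text \<open>Both differentials obey the same sum and product rules, so the coefficients arise by
  induction on the construction of \<open>F\<close>.\<close>

lemma length_gradient_exists:
  fixes p q :: "'v \<Rightarrow> real ^ 'd::finite"
  assumes E: "finite E" and len: "\<forall>(x, y)\<in>E. norm (p x - p y) = norm (q x - q y)"
    and F: "F \<in> polyfun (sqlens E)"
  shows "\<exists>k. length_gradient E p q F k"
  using F
proof induction
  case (const c)
  show ?case by (intro exI[of _ "\<lambda>_. 0"]) (auto simp: length_gradient_def derivation_of_rat)
next
  case (gen F)
  then obtain x y where xy: "(x, y) \<in> E" "F = (\<lambda>r. (norm (r x - r y))\<^sup>2)"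
    by (auto simp: sqlens_def)
  define k where "k e = (if e = (x, y) then 1 else 0 :: real)" for e
  have k: "(\<Sum>(a, b)\<in>E. k (a, b) * h a b) = h x y" for h
  proof -
    have "(\<Sum>(a, b)\<in>E. k (a, b) * h a b) = (\<Sum>e\<in>E. if e = (x, y) then h x y else 0)"
      by (intro sum.cong) (auto simp: k_def split: if_splits)
    then show ?thesis using E xy(1) by simp
  qed
  have "((\<lambda>t. F (\<lambda>w. q w + t *\<^sub>R m w)) has_real_derivative 2 * ((q x - q y) \<bullet> (m x - m y))) (at 0)" for m
    unfolding xy(2) by (rule norm_square_line_derivative)
  then show ?case by (intro exI[of _ k]) (simp add: length_gradient_def k xy(2))
next
  case (add F H)
  then obtain k l where k: "length_gradient E p q F k" and l: "length_gradient E p q H l" by blast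
  note k = k[unfolded length_gradient_def, THEN conjunct1, rule_format]
      k[unfolded length_gradient_def, THEN conjunct2, rule_format]
    and l = l[unfolded length_gradient_def, THEN conjunct1, rule_format]
      l[unfolded length_gradient_def, THEN conjunct2, rule_format]
  have s: "(\<Sum>(x, y)\<in>E. (k (x, y) + l (x, y)) * h x y) =
      (\<Sum>(x, y)\<in>E. k (x, y) * h x y) + (\<Sum>(x, y)\<in>E. l (x, y) * h x y)" for h
    by (simp add: sum.distrib case_prod_unfold distrib_right)
  show ?case unfolding length_gradient_def
    by (intro exI[of _ "\<lambda>e. k e + l e"] conjI allI impI)
      (use DERIV_add[OF k(1) l(1)] k(2) l(2) in \<open>simp_all only: s derivation_add\<close>)
next
  case (mult F H)
  then obtain k l where k: "length_gradient E p q F k" and l: "length_gradient E p q H l" by blast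
  note k = k[unfolded length_gradient_def, THEN conjunct1, rule_format]
      k[unfolded length_gradient_def, THEN conjunct2, rule_format]
    and l = l[unfolded length_gradient_def, THEN conjunct1, rule_format]
      l[unfolded length_gradient_def, THEN conjunct2, rule_format]
  \<comment> \<open>The product rule brings in values at \<open>q\<close> for one differential and
    at \<open>p\<close> for the other. They agree because functions of edge lengths do not
    distinguish equivalent frameworks.\<close>
  have eq: "F q = F p" "H q = H p"
    using polyfun_sqlens_cong[OF mult.hyps(1) len] polyfun_sqlens_cong[OF mult.hyps(2) len]
    by simp_all
  have s: "(\<Sum>(x, y)\<in>E. (F p * l (x, y) + H p * k (x, y)) * h x y) =
      F p * (\<Sum>(x, y)\<in>E. l (x, y) * h x y) + H p * (\<Sum>(x, y)\<in>E. k (x, y) * h x y)" for h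
    by (simp add: sum.distrib sum_distrib_left case_prod_unfold algebra_simps)
  have "((\<lambda>t. F (\<lambda>w. q w + t *\<^sub>R m w) * H (\<lambda>w. q w + t *\<^sub>R m w)) has_real_derivative
      F p * (\<Sum>(x, y)\<in>E. l (x, y) * (2 * ((q x - q y) \<bullet> (m x - m y)))) +
      H p * (\<Sum>(x, y)\<in>E. k (x, y) * (2 * ((q x - q y) \<bullet> (m x - m y))))) (at 0)" for m
    using DERIV_mult[OF k(1)[of m] l(1)[of m]] by (simp add: eq algebra_simps)
  then show ?case unfolding length_gradient_def
    by (intro exI[of _ "\<lambda>e. F p * l e + H p * k e"] conjI allI impI)
      (use k(2) l(2) in \<open>simp_all only: s derivation_mult\<close>)
qed

section \<open>Differentiating the minimal polynomial of a length\<close>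

lemma poly_pderiv_sum:
  fixes f :: "real poly"
  shows "poly (pderiv f) x = (\<Sum>i\<le>degree f. coeff f i * (of_nat i * x ^ (i - 1)))"
proof (rule DERIV_unique)
  show "(poly f has_real_derivative poly (pderiv f) x) (at x)" by (rule poly_DERIV)
  have "poly f = (\<lambda>x. \<Sum>i\<le>degree f. coeff f i * x ^ i)" by (simp add: fun_eq_iff poly_altdef)
  then show "(poly f has_real_derivative (\<Sum>i\<le>degree f. coeff f i * (of_nat i * x ^ (i - 1)))) (at x)"
    by (auto intro!: derivative_eq_intros simp: algebra_simps)
qed

text \<open>\<open>D\<close> may kill leading coefficients and lower the degree; the sum is padded
  with zeros up to \<open>degree f\<close>.\<close>

lemma poly_map_poly_sum:
  fixes f :: "real poly" and D :: "real \<Rightarrow> real"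
  assumes "D 0 = 0"
  shows "poly (map_poly D f) x = (\<Sum>i\<le>degree f. D (coeff f i) * x ^ i)"
proof -
  have "poly (map_poly D f) x = (\<Sum>i\<le>degree (map_poly D f). D (coeff f i) * x ^ i)"
    by (simp add: poly_altdef coeff_map_poly assms)
  also have "\<dots> = (\<Sum>i\<le>degree f. D (coeff f i) * x ^ i)"
  proof (rule sum.mono_neutral_left)
    have "degree (map_poly D f) \<le> degree f"
      by (rule degree_le) (simp add: coeff_map_poly coeff_eq_0 assms)
    then show "{..degree (map_poly D f)} \<subseteq> {..degree f}" by simp
    show "\<forall>i\<in>{..degree f} - {..degree (map_poly D f)}. D (coeff f i) * x ^ i = 0"
      using coeff_eq_0[of "map_poly D f"] by (auto simp: coeff_map_poly assms)
  qed simp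
  finally show ?thesis .
qed

text \<open>\<beta> is a conjugate of the squared length in \<open>p\<close>, a simple root of the
  same minimal polynomial. Implicit differentiation expresses its first-order changes through the
  edges, with the same weights for motions of \<open>q\<close> and for derivations.\<close>

lemma algebraic_length_stress:
  fixes p q :: "'v \<Rightarrow> real ^ 'd::finite"
  assumes p: "independent_coords (W \<times> UNIV) p" and E: "finite E" "E \<subseteq> W \<times> W"
    and len: "\<forall>(x, y)\<in>E. norm (p x - p y) = norm (q x - q y)"
    and uv: "u \<in> W" "v \<in> W"
    and alg: "algebraic_over ((\<lambda>F. F p) ` polyfun (sqlens E)) ((norm (p u - p v))\<^sup>2)"
  defines "\<beta> \<equiv> (norm (q u - q v))\<^sup>2"
  shows "algebraic_over ((\<lambda>F. F p) ` polyfun (sqlens E)) \<beta>"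
    and "\<beta> = 0 \<Longrightarrow> p u = p v"
    and "\<exists>b. (\<forall>m. (q u - q v) \<bullet> (m u - m v) = (\<Sum>(x, y)\<in>E. b (x, y) * ((q x - q y) \<bullet> (m x - m y)))) \<and>
      (\<forall>D. derivation D \<longrightarrow> D \<beta> = (\<Sum>(x, y)\<in>E. b (x, y) * D ((norm (p x - p y))\<^sup>2)))"
proof -
  let ?M = "(\<lambda>F. F p) ` polyfun (sqlens E)"
  define g where "g r = (norm (r u - r v))\<^sup>2" for r :: "'v \<Rightarrow> real ^ 'd"
  have M: "subring ?M" by (rule subring_polyfun_values)
  obtain f where f: "minpoly ?M (g p) f" using minpoly_exists[OF alg] unfolding g_def by blast
  have f': "coeffs_in ?M f" "f \<noteq> 0" "poly f (g p) = 0" using f by (auto simp: minpoly_def)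
  obtain F where F: "\<And>i. F i \<in> polyfun (sqlens E)" "\<And>i. coeff f i = F i p"
    using coeffs_in_polyfun_values[OF f'(1)] by blast
  have Fq: "F i q = coeff f i" for i
    using polyfun_sqlens_cong[OF F(1) len] F(2) by simp
  have gpoly: "g \<in> polyfun (coords (W \<times> UNIV))" unfolding g_def using sqlen_polyfun[OF uv] .
  \<comment> \<open>The relation at the generic \<open>p\<close> is an identity in \<open>r\<close>:
    at \<open>q\<close> it makes \<beta> a root, and it can be differentiated along lines through
    \<open>q\<close>.\<close>
  have rel: "(\<Sum>i\<le>degree f. F i r * g r ^ i) = 0" for r
    using poly_relation_polyfun[where F = F and I = "W \<times> UNIV", OF p _ gpoly F(2) f'(3)] F(1) sqlens_polyfun[OF E(2)] by blast
  have \<beta>: "\<beta> = g q" by (simp add: \<beta>_def g_def)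
  have root: "poly f \<beta> = 0" using rel[of q] by (simp add: poly_altdef Fq \<beta>)
  have m\<beta>: "minpoly ?M \<beta> f" using minpoly_root[OF M f root] .
  then show alg\<beta>: "algebraic_over ?M \<beta>" by (auto simp: minpoly_def algebraic_over_def)
  define d where "d = poly (pderiv f) \<beta>"
  have d: "d \<noteq> 0" unfolding d_def using minpoly_pderiv[OF M m\<beta>] .
  \<comment> \<open>A root 0 means that \<open>f\<close> is X times \<open>h\<close>. By minimality
    \<open>h\<close> does not vanish at the squared length in \<open>p\<close>, which is therefore
    0.\<close>
  show "p u = p v" if "\<beta> = 0"
  proof -
    obtain c h where h: "f = pCons c h" by (cases f)
    have "c = 0" using root that h by simp
    have "h \<noteq> 0" using f'(2) h \<open>c = 0\<close> by auto
    have "coeff h i \<in> ?M" for i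
      using f'(1)[unfolded coeffs_in_def, rule_format, of "Suc i"] by (simp add: h)
    then have "coeffs_in ?M h" by (simp add: coeffs_in_def)
    moreover have "\<not> degree f \<le> degree h" using h \<open>h \<noteq> 0\<close> by simp
    ultimately have "poly h (g p) \<noteq> 0" using f \<open>h \<noteq> 0\<close> by (auto simp: minpoly_def)
    moreover have "g p * poly h (g p) = 0" using f'(3) h \<open>c = 0\<close> by simp
    ultimately show ?thesis by (simp add: g_def)
  qed
  have "\<forall>i. \<exists>k. length_gradient E p q (F i) k"
    using length_gradient_exists[OF E(1) len F(1)] by blast
  then obtain K where K: "\<And>i. length_gradient E p q (F i) (K i)" by metis
  note K = K[unfolded length_gradient_def, THEN conjunct1, rule_format]
    K[unfolded length_gradient_def, THEN conjunct2, rule_format]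
  \<comment> \<open>Solves \<Sum>(dF_i) \<beta>^i + f'(\<beta>) d\<beta> = 0 for d\<beta>, where
    \<open>K i\<close> holds the coefficients of dF_i.\<close>
  define b where "b e = - (\<Sum>i\<le>degree f. K i e * \<beta> ^ i) / d" for e
  have b: "(\<Sum>i\<le>degree f. (\<Sum>(x, y)\<in>E. K i (x, y) * h x y) * \<beta> ^ i) =
      - d * (\<Sum>(x, y)\<in>E. b (x, y) * h x y)" for h
  proof -
    have "(\<Sum>i\<le>degree f. (\<Sum>(x, y)\<in>E. K i (x, y) * h x y) * \<beta> ^ i) =
        (\<Sum>i\<le>degree f. \<Sum>(x, y)\<in>E. K i (x, y) * \<beta> ^ i * h x y)"
      by (simp add: sum_distrib_left case_prod_unfold algebra_simps)
    also have "\<dots> = (\<Sum>(x, y)\<in>E. \<Sum>i\<le>degree f. K i (x, y) * \<beta> ^ i * h x y)"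
      by (subst sum.swap) (simp add: case_prod_unfold)
    also have "\<dots> = (\<Sum>(x, y)\<in>E. - d * (b (x, y) * h x y))"
      using d by (simp add: b_def sum_distrib_right)
    finally show ?thesis by (simp add: sum_distrib_left case_prod_unfold)
  qed
  have "(q u - q v) \<bullet> (m u - m v) = (\<Sum>(x, y)\<in>E. b (x, y) * ((q x - q y) \<bullet> (m x - m y)))" for m
  proof -
    let ?r = "\<lambda>t w. q w + t *\<^sub>R m w"
    let ?dg = "2 * ((q u - q v) \<bullet> (m u - m v))"
    let ?dF = "\<lambda>i. \<Sum>(x, y)\<in>E. K i (x, y) * (2 * ((q x - q y) \<bullet> (m x - m y)))"
    have dg: "((\<lambda>t. g (?r t)) has_real_derivative ?dg) (at 0)"
      unfolding g_def by (rule norm_square_line_derivative)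
    have 0: "?r 0 = q" by simp
    have "((\<lambda>t. \<Sum>i\<le>degree f. F i (?r t) * g (?r t) ^ i) has_real_derivative
        (\<Sum>i\<le>degree f. F i q * (of_nat i * (?dg * \<beta> ^ (i - 1))) + ?dF i * \<beta> ^ i)) (at 0)"
      using DERIV_mult'[OF K(1) DERIV_power[OF dg]] unfolding 0 \<beta> by (intro DERIV_sum) simp
    moreover have "((\<lambda>t. \<Sum>i\<le>degree f. F i (?r t) * g (?r t) ^ i) has_real_derivative 0) (at 0)"
      unfolding rel by simp
    ultimately have "(\<Sum>i\<le>degree f. F i q * (of_nat i * (?dg * \<beta> ^ (i - 1))) + ?dF i * \<beta> ^ i) = 0"
      by (rule DERIV_unique)
    moreover have "(\<Sum>i\<le>degree f. F i q * (of_nat i * (?dg * \<beta> ^ (i - 1)))) = ?dg * d"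
      unfolding d_def poly_pderiv_sum sum_distrib_left by (simp add: Fq algebra_simps)
    ultimately have "?dg * d + - d * (\<Sum>(x, y)\<in>E. b (x, y) * (2 * ((q x - q y) \<bullet> (m x - m y)))) = 0"
      by (simp only: sum.distrib b)
    then have "d * (?dg - (\<Sum>(x, y)\<in>E. b (x, y) * (2 * ((q x - q y) \<bullet> (m x - m y))))) = 0"
      by (simp only: right_diff_distrib) (simp only: mult.commute mult_minus_left add_uminus_conv_diff)
    then have "?dg = (\<Sum>(x, y)\<in>E. b (x, y) * (2 * ((q x - q y) \<bullet> (m x - m y))))"
      using d by simp
    also have "\<dots> = 2 * (\<Sum>(x, y)\<in>E. b (x, y) * ((q x - q y) \<bullet> (m x - m y)))"
      by (simp add: sum_distrib_left case_prod_unfold algebra_simps)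
    finally show ?thesis by simp
  qed
  moreover have "D \<beta> = (\<Sum>(x, y)\<in>E. b (x, y) * D ((norm (p x - p y))\<^sup>2))" if D: "derivation D" for D
  proof -
    have "0 = poly (map_poly D f) \<beta> + d * D \<beta>"
      using derivation_poly[OF D, of f \<beta>] root derivation_0[OF D] by (simp add: d_def)
    also have "poly (map_poly D f) \<beta> = - d * (\<Sum>(x, y)\<in>E. b (x, y) * D ((norm (p x - p y))\<^sup>2))"
      unfolding poly_map_poly_sum[of D, OF derivation_0[OF D]] F(2) K(2)[OF D] b ..
    finally show ?thesis using d by simp
  qed
  ultimately show "\<exists>b. (\<forall>m. (q u - q v) \<bullet> (m u - m v) = (\<Sum>(x, y)\<in>E. b (x, y) * ((q x - q y) \<bullet> (m x - m y)))) \<and>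
      (\<forall>D. derivation D \<longrightarrow> D \<beta> = (\<Sum>(x, y)\<in>E. b (x, y) * D ((norm (p x - p y))\<^sup>2)))"
    by blast
qed

section \<open>Combining the stress with the vertex deletions\<close>

lemma finite_simple_graph_delete_vertex:
  "finite_simple_graph G \<Longrightarrow> finite_simple_graph (delete_vertex G z)"
  by (auto simp: finite_simple_graph_def delete_vertex_def)

lemma independent_coords_mono:
  assumes "independent_coords J p" "I \<subseteq> J" shows "independent_coords I p"
  using assms unfolding alg_independent_over_rat_def by (meson order_trans)

text \<open>By \<open>zero\<close> the functional sees only \<open>u\<close> and \<open>v\<close>.
  It vanishes on translations, so its parts at \<open>u\<close> and \<open>v\<close> are
  opposite.\<close>

lemma edge_functional_supported:
  fixes p :: "'v \<Rightarrow> real ^ 'd::finite"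
  assumes W: "finite W" "E \<subseteq> W \<times> W" and uv: "u \<in> W" "v \<in> W" "u \<noteq> v"
    and zero: "\<And>z i. z \<in> W - {u, v} \<Longrightarrow>
      (\<Sum>(x, y)\<in>E. b (x, y) * ((p x - p y) \<bullet> ((if x = z then axis i 1 else 0) - (if y = z then axis i 1 else 0)))) = 0"
  shows "\<exists>\<gamma>. \<forall>m. (\<Sum>(x, y)\<in>E. b (x, y) * ((p x - p y) \<bullet> (m x - m y))) = \<gamma> \<bullet> (m u - m v)"
proof -
  define L where "L m = (\<Sum>(x, y)\<in>E. b (x, y) * ((p x - p y) \<bullet> (m x - m y)))" for m
  define e where "e z i = (\<lambda>w. if w = z then axis i 1 else 0 :: real ^ 'd)" for z :: 'v and i
  define \<gamma> where "\<gamma> = (\<chi> i. L (e u i))"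
  have cong: "L m = L n" if "\<And>w. w \<in> W \<Longrightarrow> m w = n w" for m n
    unfolding L_def using that W(2) by (intro sum.cong) auto
  have L0: "L (\<lambda>_. c) = 0" for c by (simp add: L_def)
  have add: "L (\<lambda>w. m w + n w) = L m + L n" for m n
    unfolding L_def sum.distrib[symmetric]
    by (intro sum.cong) (auto simp: inner_add_right inner_diff_right algebra_simps)
  have scale: "L (\<lambda>w. c *\<^sub>R m w) = c * L m" for c m
    unfolding L_def sum_distrib_left
    by (intro sum.cong) (auto simp: inner_diff_right algebra_simps)
  have LsumW: "L (\<lambda>w. \<Sum>j\<in>A. h j w) = (\<Sum>j\<in>A. L (h j))" for A :: "'v set" and h
    by (induction A rule: infinite_finite_induct) (simp_all add: L0 add)
  have LsumUNIV: "L (\<lambda>w. \<Sum>j\<in>A. h j w) = (\<Sum>j\<in>A. L (h j))" for A :: "'d set" and h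
    by (induction A rule: infinite_finite_induct) (simp_all add: L0 add)
  have expand: "L m = (\<Sum>i\<in>UNIV. m u $ i * L (e u i)) + (\<Sum>i\<in>UNIV. m v $ i * L (e v i))" for m
  proof -
    have "m w = (\<Sum>z\<in>W. \<Sum>i\<in>UNIV. m z $ i *\<^sub>R e z i w)" if "w \<in> W" for w
    proof -
      have "(\<Sum>i\<in>UNIV. m z $ i *\<^sub>R e z i w) = (if z = w then m w else 0)" for z
        using basis_expansion[of "m w"] by (simp add: e_def scalar_mult_eq_scaleR)
      then show ?thesis using W(1) that by simp
    qed
    then have "L m = L (\<lambda>w. \<Sum>z\<in>W. \<Sum>i\<in>UNIV. m z $ i *\<^sub>R e z i w)" by (rule cong)
    also have "\<dots> = (\<Sum>z\<in>W. \<Sum>i\<in>UNIV. m z $ i * L (e z i))"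
      by (simp add: LsumW LsumUNIV scale)
    also have "\<dots> = (\<Sum>z\<in>{u, v}. \<Sum>i\<in>UNIV. m z $ i * L (e z i))"
    proof (rule sum.mono_neutral_right)
      show "\<forall>z\<in>W - {u, v}. (\<Sum>i\<in>UNIV. m z $ i * L (e z i)) = 0"
        using zero by (simp add: L_def e_def)
    qed (use W uv in auto)
    finally show ?thesis using uv(3) by simp
  qed
  have "L (e v i) = - \<gamma> $ i" for i
    using expand[of "\<lambda>_. axis i 1"] L0[of "axis i 1"]
    by (simp add: \<gamma>_def axis_def if_distrib[of "\<lambda>x. x * _"] cong: if_cong)
  then have "L m = \<gamma> \<bullet> (m u - m v)" for m
    using expand[of m] by (simp add: \<gamma>_def inner_vec_def algebra_simps sum_subtractf sum_negf)
  then show ?thesis unfolding L_def by blast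
qed

theorem theorem1p5:
  fixes G :: "'v graph" and u v :: 'v
  assumes "finite_simple_graph G"
    and "card (verts G) \<ge> 3"
    and "u \<in> verts G" and "v \<in> verts G"
    and "vertex_redundantly_linked TYPE('d::finite) G u v"
  shows "globally_linked TYPE('d) G u v"
  unfolding globally_linked_def
proof (intro allI impI, elim conjE)
  fix p q :: "'v \<Rightarrow> real ^ 'd"
  assume p: "generic G p"
    and len: "\<forall>x y. {x, y} \<in> edges G \<longrightarrow> norm (p x - p y) = norm (q x - q y)"
  show "norm (p u - p v) = norm (q u - q v)"
  proof (cases "u = v")
    case uv: False
    define \<beta> where "\<beta> = (norm (q u - q v))\<^sup>2"
    let ?V = "verts G" and ?E = "\<lambda>z. arcs (delete_vertex G z)"
    have ind: "independent_coords (?V \<times> UNIV) p" using p by (simp add: generic_def)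
    have E: "finite (?E z)" "?E z \<subseteq> (?V - {z}) \<times> (?V - {z})" for z
      using finite_simple_graph_delete_vertex[OF assms(1), of z] finite_arcs[of "delete_vertex G z"]
        arcs_subset[of "delete_vertex G z"] by (auto simp: delete_vertex_def)
    have E': "?E z \<subseteq> ?V \<times> ?V" for z using E(2)[of z] by blast
    have lenE: "\<forall>(x, y)\<in>?E z. norm (p x - p y) = norm (q x - q y)" for z
      using len by (simp add: arcs_def delete_vertex_def)
    have alg: "algebraic_over ((\<lambda>F. F p) ` polyfun (sqlens (?E z))) ((norm (p u - p v))\<^sup>2)"
      if z: "z \<in> ?V - {u, v}" for z
    proof (rule linked_imp_algebraic[OF finite_simple_graph_delete_vertex[OF assms(1)] _ _ uv])
      show "u \<in> verts (delete_vertex G z)" "v \<in> verts (delete_vertex G z)"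
        using assms(3,4) z by (auto simp: delete_vertex_def)
      show "generic (delete_vertex G z) p"
        using independent_coords_mono[OF ind Sigma_mono[OF Diff_subset subset_refl]]
        by (simp add: generic_def delete_vertex_def)
      show "linked TYPE('d) (delete_vertex G z) u v"
        using assms(5) z by (simp add: vertex_redundantly_linked_def)
    qed
    note stress = algebraic_length_stress[OF ind E(1) E' lenE assms(3,4) alg, folded \<beta>_def]
    have "\<not> ?V \<subseteq> {u, v}"
    proof
      assume "?V \<subseteq> {u, v}"
      then have "card ?V \<le> card {u, v}" by (intro card_mono) auto
      then show False using assms(2) uv by simp
    qed
    \<comment> \<open>The weights \<open>b\<close> come from this one deletion. Each deletion of a
      vertex z shows that \<beta> is algebraic over lengths avoiding z.\<close>
    then obtain z0 where z0: "z0 \<in> ?V - {u, v}" by blast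
    let ?A = "?E z0"
    obtain b where b: "\<And>m. (q u - q v) \<bullet> (m u - m v) =
        (\<Sum>(x, y)\<in>?A. b (x, y) * ((q x - q y) \<bullet> (m x - m y)))"
      and bD: "\<And>D. derivation D \<Longrightarrow> D \<beta> = (\<Sum>(x, y)\<in>?A. b (x, y) * D ((norm (p x - p y))\<^sup>2))"
      using stress(3)[OF z0] by blast
    have "(\<Sum>(x, y)\<in>?A. b (x, y) *
        ((p x - p y) \<bullet> ((if x = z then axis i 1 else 0) - (if y = z then axis i 1 else 0)))) = 0"
      if z: "z \<in> ?V - {u, v}" for z i
    proof -
      \<comment> \<open>\<open>D\<close> extends the partial derivative in the coordinate (z, i) of
        \<open>p\<close>. It kills \<beta>, which is algebraic over lengths not involving
        \<open>z\<close>, while on edge lengths it acts as the unit motion of \<open>z\<close> in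
        direction \<open>i\<close>.\<close>
      let ?J = "?V \<times> UNIV - {(z, i)}"
      have "(z, i) \<in> ?V \<times> UNIV" using z by simp
      from derivation_exists[OF subring_polyfun_values generic_coord_not_algebraic[OF ind this]]
      obtain D where D: "derivation D" "\<And>c. c \<in> (\<lambda>F. F p) ` polyfun (coords ?J) \<Longrightarrow> D c = 0"
        "D (p z $ i) = 1" by blast
      have "polyfun (sqlens (?E z)) \<subseteq> polyfun (coords ((?V - {z}) \<times> UNIV))"
        by (rule sqlens_polyfun[OF E(2)])
      also have "\<dots> \<subseteq> polyfun (coords ?J)" by (rule coords_mono) auto
      finally have "D c = 0" if "c \<in> (\<lambda>F. F p) ` polyfun (sqlens (?E z))" for c
        using that D(2) by blast
      then have D\<beta>: "D \<beta> = 0"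
        using derivation_algebraic[OF D(1) subring_polyfun_values _ stress(1)[OF z]] by blast
      have "D (p w $ j) = 0" if "w \<in> ?V" "(w, j) \<noteq> (z, i)" for w j
      proof -
        have "(\<lambda>r. r w $ j) \<in> polyfun (coords ?J)"
          unfolding coords_def using that by (intro polyfun.gen) force
        then show ?thesis using D(2) by blast
      qed
      then have vel: "(\<chi> j. D (p w $ j)) = (if w = z then axis i 1 else 0)" if "w \<in> ?V" for w
        using that D(3) by (auto simp: vec_eq_iff axis_def)
      have "0 = (\<Sum>(x, y)\<in>?A. b (x, y) * D ((norm (p x - p y))\<^sup>2))" using bD[OF D(1)] D\<beta> by simp
      also have "\<dots> = (\<Sum>(x, y)\<in>?A. 2 * (b (x, y) *
          ((p x - p y) \<bullet> ((if x = z then axis i 1 else 0) - (if y = z then axis i 1 else 0)))))"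
      proof (rule sum.cong[OF refl])
        fix e assume "e \<in> ?A"
        then obtain x y where e: "e = (x, y)" "x \<in> ?V" "y \<in> ?V" using E' by blast
        show "(case e of (x, y) \<Rightarrow> b (x, y) * D ((norm (p x - p y))\<^sup>2)) = (case e of (x, y) \<Rightarrow> 2 * (b (x, y) *
          ((p x - p y) \<bullet> ((if x = z then axis i 1 else 0) - (if y = z then axis i 1 else 0)))))"
          unfolding e(1) prod.case derivation_norm_square[OF D(1)] vel[OF e(2)] vel[OF e(3)] by simp
      qed
      finally show ?thesis by (simp add: sum_distrib_left[symmetric] case_prod_unfold)
    qed
    moreover have "finite ?V" using assms(1) by (simp add: finite_simple_graph_def)
    ultimately obtain \<gamma> where \<gamma>: "\<And>m. (\<Sum>(x, y)\<in>?A. b (x, y) * ((p x - p y) \<bullet> (m x - m y))) = \<gamma> \<bullet> (m u - m v)"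
      using edge_functional_supported[OF _ E' assms(3,4) uv] by blast
    show ?thesis
    proof (cases "q u = q v")
      \<comment> \<open>Here \<beta> = 0, so both distances are 0.\<close>
      case True
      then show ?thesis using stress(2)[OF z0] by (simp add: \<beta>_def)
    next
      case False
      then obtain j where j: "(q u - q v) $ j \<noteq> 0" by (auto simp: vec_eq_iff)
      have "(p u - p v) $ i = \<gamma> $ i" for i
      proof -
        \<comment> \<open>The stress at \<open>q\<close> is tested with coordinate \<open>i\<close>
          of \<open>p\<close> placed in direction \<open>j\<close>, the functional at
          \<open>p\<close> with coordinate \<open>j\<close> of \<open>q\<close> placed in direction
          \<open>i\<close>. Both give the same sum over edges.\<close>
        have "(q u - q v) $ j * (p u - p v) $ i =
            (q u - q v) \<bullet> (p u $ i *\<^sub>R axis j 1 - p v $ i *\<^sub>R axis j 1)"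
          by (simp add: inner_axis scaleR_diff_left[symmetric])
        also have "\<dots> = (\<Sum>(x, y)\<in>?A. b (x, y) * ((q x - q y) \<bullet> (p x $ i *\<^sub>R axis j 1 - p y $ i *\<^sub>R axis j 1)))"
          using b[of "\<lambda>w. p w $ i *\<^sub>R axis j 1"] .
        also have "\<dots> = (\<Sum>(x, y)\<in>?A. b (x, y) * ((p x - p y) \<bullet> (q x $ j *\<^sub>R axis i 1 - q y $ j *\<^sub>R axis i 1)))"
          by (intro sum.cong) (auto simp: inner_axis scaleR_diff_left[symmetric])
        also have "\<dots> = (q u - q v) $ j * \<gamma> $ i"
          using \<gamma>[of "\<lambda>w. q w $ j *\<^sub>R axis i 1"] by (simp add: inner_axis scaleR_diff_left[symmetric])
        finally show ?thesis using j by simp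
      qed
      then have "\<gamma> = p u - p v" by (simp add: vec_eq_iff)
      \<comment> \<open>Each framework now serves as its own test motion; equal edge lengths make
        the weighted sums coincide.\<close>
      then have "(norm (p u - p v))\<^sup>2 = (\<Sum>(x, y)\<in>?A. b (x, y) * ((p x - p y) \<bullet> (p x - p y)))"
        using \<gamma>[of p] by (simp add: power2_norm_eq_inner)
      also have "\<dots> = (\<Sum>(x, y)\<in>?A. b (x, y) * ((q x - q y) \<bullet> (q x - q y)))"
        using lenE[of z0] by (intro sum.cong) (auto simp: power2_norm_eq_inner[symmetric])
      also have "\<dots> = (norm (q u - q v))\<^sup>2" using b[of q] by (simp add: power2_norm_eq_inner)
      finally show ?thesis by simp
    qed
  qed simp
qed

end
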